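(* Let $q\in C^{1}[0,b]$ be a complex valued function, and let $u(\omega,x)$, $Q$, $K_{22}$, $\alpha_n$, $j_n$, $\varepsilon_N$ be as defined in the context. The solution $u(\omega,x)$ admits the following representation $$u(\omega,x)=e^{i\omega x}\left(1+\frac{Q(x)}{2i\omega}+\frac{1}{\omega^{2}}\left(\frac{q(x)}{4}-\frac{Q^{2}(x)}{8}\right)\right)-\frac{q(0)}{4}\frac{e^{-i\omega x}}{\omega^{2}}-\frac{1}{\omega^{2}}\sum_{n=0}^{\infty}i^{n}\alpha_{n}(x)j_{n}(\omega x),$$ where the series converges for any $x$ on the segment $[0,b]$ and converges uniformly on any compact subset of the complex plane with respect to $\omega$. Moreover, the following estimate is valid: $$|u(\omega,x)-u_{N}(\omega,x)|\le\frac{1}{|\omega|^{2}}\,\varepsilon_{N}(x)\sqrt{\frac{\sinh(2\,\mathrm{Im}\,\omega\,x)}{\mathrm{Im}\,\omega}}\qquad\text{for any }\omega\in\mathbb{C}\setminus\{0\},$$ where $$u_{N}(\omega,x):=e^{i\omega x}\left(1+\frac{Q(x)}{2i\omega}+\frac{1}{\omega^{2}}\left(\frac{q(x)}{4}-\frac{Q^{2}(x)}{8}\right)\right)-\frac{q(0)}{4}\frac{e^{-i\omega x}}{\omega^{2}}-\frac{1}{\omega^{2}}\sum_{n=0}^{N}i^{n}\alpha_{n}(x)j_{n}(\omega x).$$ In particular, for all $\omega\in\mathbb{R}\setminus\{0\}$ the estimate has the form $$|u(\omega,x)-u_{N}(\omega,x)|\le\frac{1}{|\omega|^{2}}\,\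varepsilon_{N}(x)\sqrt{2x}.$$
   Context: For $\omega\in\mathbb{C}$, $u(\omega,x)$ denotes the solution of $-u''+q(x)u=\omega^{2}u$ on $(0,b)$ (derivatives in $x$) satisfying $u(\omega,0)=1$, $u'(\omega,0)=i\omega$. Put $Q(x):=\int_{0}^{x}q(s)\,ds$. The transmutation kernel $K(x,t)$ is the function defined on $0\le|t|\le x\le b$, twice continuously differentiable with respect to each of its arguments, such that $u(\omega,x)=e^{i\omega x}+\int_{-x}^{x}K(x,t)e^{i\omega t}\,dt$ for all $\omega\in\mathbb{C}$, with $K(x,x)=Q(x)/2$ and $K(x,-x)=0$ for all $x\in[0,b]$; it satisfies the integral equation $$K(x,t)=\frac12 Q\left(\frac{x+t}{2}\right)+\int_{0}^{\frac{x+t}{2}}\int_{0}^{\frac{x-t}{2}}q(\alpha+\beta)K(\alpha+\beta,\alpha-\beta)\,d\beta\,d\alpha .$$ $K_{22}$ denotes the second partial derivative of $K$ with respect to its second argument. $P_n$ is the Legendre polynomial of order $n$, and $j_n$ is the spherical Bessel function of order $n$. The functions $\alpha_n$ are the coefficients of the Fourier-Legendre expansion $$K_{22}(x,t)=\sum_{n=0}^{\infty}\frac{\alpha_n(x)}{x}P_n\left(\frac{t}{x}\right),$$ convergent for each fixed $x$ in the sense of the $L_2(-x,x)$-norm in $t$, that is, $$\alpha_n(x)=\frac{2n+1}{2}\int_{-x}^{x}K_{22}(x,t)P_n\left(\frac{t}{x}\right)dt .$$ Finally, with $K_{22,N}(x,t):=\sum_{n=0}^{N}\frac{\alpha_n(x)}{x}P_n\left(\frac{t}{x}\right)$,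 $$\varepsilon_N(x):=\left\|K_{22}(x,\cdot)-K_{22,N}(x,\cdot)\right\|_{L_2(-x,x)},$$ which tends to $0$ as $N\to\infty$ for all $x\in[0,b]$.
   Formalization: The coefficient of the Bessel series in the representation and in u_N is 2/ω² instead of 1/ω²; with the given α_n the printed 1/ω² is false (e.g. q=1, x=ω=1), since the integral of P_n(t/x)e^{iωt} over (-x,x) is 2x i^n j_n(ωx). *)

theory Defs
  imports "HOL-Analysis.Analysis" "HOL-Computational_Algebra.Polynomial"
begin

text \<open>One-sided derivatives at the end points: nothing is required of \<open>q\<close> outside \<open>[0, b]\<close>
  (unlike \<open>C1_differentiable_on\<close>, which uses two-sided derivatives).\<close>

definition C1_interval :: "real \<Rightarrow> (real \<Rightarrow> complex) \<Rightarrow> bool" where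
  "C1_interval b q \<longleftrightarrow>
     (\<exists>q'. (\<forall>x\<in>{0..b}. (q has_vector_derivative q' x) (at x within {0..b})) \<and>
           continuous_on {0..b} q')"

definition Qint :: "(real \<Rightarrow> complex) \<Rightarrow> real \<Rightarrow> complex" where
  "Qint q x = integral {0..x} q"

definition sl_solution :: "real \<Rightarrow> (real \<Rightarrow> complex) \<Rightarrow> complex \<Rightarrow> (real \<Rightarrow> complex) \<Rightarrow> bool" where
  "sl_solution b q \<omega> y \<longleftrightarrow>
     (\<exists>y' y''.
        (\<forall>x\<in>{0..b}. (y has_vector_derivative y' x) (at x within {0..b})) \<and>
        continuous_on {0..b} y' \<and>
        (\<forall>x\<in>{0<..<b}. (y' has_vector_derivative y'' x) (at x) \<and>
                       - y'' x + q x * y x = \<omega>\<^sup>2 * y x) \<and>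
        y 0 = 1 \<and> y' 0 = \<i> * \<omega>)"

definition kernel_domain :: "real \<Rightarrow> (real \<times> real) set" where
  "kernel_domain b = {(x, t). \<bar>t\<bar> \<le> x \<and> x \<le> b}"

text \<open>Partial derivatives are taken along the slices of the closed triangle. At the vertices
  some slices are single points, where every number is a derivative; there the values of the
  partial derivatives are fixed by their continuity on the triangle.\<close>

definition C2_each_argument :: "real \<Rightarrow> (real \<Rightarrow> real \<Rightarrow> complex) \<Rightarrow> bool" where
  "C2_each_argument b K \<longleftrightarrow>
     (\<exists>K\<^sub>1 K\<^sub>1\<^sub>1 K\<^sub>2 K\<^sub>2\<^sub>2.
        (\<forall>(x, t)\<in>kernel_domain b.
           ((\<lambda>y. K y t) has_vector_derivative K\<^sub>1 x t) (at x within {\<bar>t\<bar>..b}) \<and>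
           ((\<lambda>y. K\<^sub>1 y t) has_vector_derivative K\<^sub>1\<^sub>1 x t) (at x within {\<bar>t\<bar>..b}) \<and>
           ((\<lambda>s. K x s) has_vector_derivative K\<^sub>2 x t) (at t within {-x..x}) \<and>
           ((\<lambda>s. K\<^sub>2 x s) has_vector_derivative K\<^sub>2\<^sub>2 x t) (at t within {-x..x})) \<and>
        (\<forall>f\<in>{K, K\<^sub>1, K\<^sub>1\<^sub>1, K\<^sub>2, K\<^sub>2\<^sub>2}. continuous_on (kernel_domain b) (\<lambda>(x, t). f x t)))"

definition transmutation_kernel ::
    "real \<Rightarrow> (real \<Rightarrow> complex) \<Rightarrow> (complex \<Rightarrow> real \<Rightarrow> complex) \<Rightarrow> (real \<Rightarrow> real \<Rightarrow> complex) \<Rightarrow> bool" where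
  "transmutation_kernel b q u K \<longleftrightarrow>
     C2_each_argument b K \<and>
     (\<forall>\<omega>. \<forall>x\<in>{0..b}. u \<omega> x = exp (\<i> * \<omega> * of_real x)
         + integral {-x..x} (\<lambda>t. K x t * exp (\<i> * \<omega> * of_real t))) \<and>
     (\<forall>x\<in>{0..b}. K x x = Qint q x / 2 \<and> K x (-x) = 0) \<and>
     (\<forall>(x, t)\<in>kernel_domain b.
        K x t = Qint q ((x + t) / 2) / 2
          + integral {0..(x + t) / 2} (\<lambda>\<alpha>. integral {0..(x - t) / 2}
              (\<lambda>\<beta>. q (\<alpha> + \<beta>) * K (\<alpha> + \<beta>) (\<alpha> - \<beta>))))"

definition partial2 :: "(real \<Rightarrow> real \<Rightarrow> complex) \<Rightarrow> real \<Rightarrow> real \<Rightarrow> complex" where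
  "partial2 K x t = vector_derivative (\<lambda>s. K x s) (at t within {-x..x})"

definition K22 :: "(real \<Rightarrow> real \<Rightarrow> complex) \<Rightarrow> real \<Rightarrow> real \<Rightarrow> complex" where
  "K22 K = partial2 (partial2 K)"

text \<open>Rodrigues' formula.\<close>

definition legendre_poly :: "nat \<Rightarrow> real poly" where
  "legendre_poly n = smult (1 / (2 ^ n * fact n)) ((pderiv ^^ n) ([:-1, 0, 1:] ^ n))"

definition legendre_P :: "nat \<Rightarrow> real \<Rightarrow> real" where
  "legendre_P n x = poly (legendre_poly n) x"

definition bessel_J :: "complex \<Rightarrow> complex \<Rightarrow> complex" where
  "bessel_J \<nu> z =
     (z / 2) powr \<nu> * (\<Sum>k. (-1) ^ k / fact k * rGamma (of_nat k + \<nu> + 1) * (z / 2) ^ (2 * k))"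

text \<open>\<open>j\<^sub>n(z) = sqrt (\<pi> / (2 z)) * J\<^bsub>n + 1/2\<^esub>(z)\<close>, continued to the removable singularity
  at \<open>0\<close>. The root of \<open>z\<close> stands in the denominator so that its branch cut cancels
  against that of \<open>(z / 2) powr (n + 1/2)\<close>, also on the negative real axis.\<close>

definition spherical_bessel_j :: "nat \<Rightarrow> complex \<Rightarrow> complex" where
  "spherical_bessel_j n z =
     (if z = 0 then (if n = 0 then 1 else 0)
      else of_real (sqrt (pi / 2)) / csqrt z * bessel_J (of_nat n + 1 / 2) z)"

definition legendre_coeff :: "(real \<Rightarrow> real \<Rightarrow> complex) \<Rightarrow> nat \<Rightarrow> real \<Rightarrow> complex" where
  "legendre_coeff K n x =
     (2 * of_nat n + 1) / 2 * integral {-x..x} (\<lambda>t. K22 K x t * of_real (legendre_P n (t / x)))"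

definition K22_partial :: "(real \<Rightarrow> real \<Rightarrow> complex) \<Rightarrow> nat \<Rightarrow> real \<Rightarrow> real \<Rightarrow> complex" where
  "K22_partial K N x t =
     (\<Sum>n\<le>N. legendre_coeff K n x / of_real x * of_real (legendre_P n (t / x)))"

definition eps :: "(real \<Rightarrow> real \<Rightarrow> complex) \<Rightarrow> nat \<Rightarrow> real \<Rightarrow> real" where
  "eps K N x = sqrt (integral {-x..x} (\<lambda>t. (cmod (K22 K x t - K22_partial K N x t))\<^sup>2))"

definition nsbf_term :: "(real \<Rightarrow> real \<Rightarrow> complex) \<Rightarrow> complex \<Rightarrow> real \<Rightarrow> nat \<Rightarrow> complex" where
  "nsbf_term K \<omega> x n = \<i> ^ n * legendre_coeff K n x * spherical_bessel_j n (\<omega> * of_real x)"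

text \<open>The factor 2 in front of the sum comes from
  \<open>\<integral>\<^bsub>[-1,1]\<^esub> P\<^sub>n(s) exp (\<i> z s) ds = 2 \<i>\<^sup>n j\<^sub>n(z)\<close>.\<close>

definition u_approx ::
    "(real \<Rightarrow> complex) \<Rightarrow> (real \<Rightarrow> real \<Rightarrow> complex) \<Rightarrow> nat \<Rightarrow> complex \<Rightarrow> real \<Rightarrow> complex" where
  "u_approx q K N \<omega> x =
     exp (\<i> * \<omega> * of_real x)
       * (1 + Qint q x / (2 * \<i> * \<omega>) + 1 / \<omega>\<^sup>2 * (q x / 4 - (Qint q x)\<^sup>2 / 8))
     - q 0 / 4 * (exp (- \<i> * \<omega> * of_real x) / \<omega>\<^sup>2)
     - 2 / \<omega>\<^sup>2 * (\<Sum>n\<le>N. nsbf_term K \<omega> x n)"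

text \<open>\<open>sinh (2 y x) / y\<close> with its limit \<open>2 x\<close> at the removable singularity \<open>y = 0\<close>.\<close>

definition sinh_quotient :: "real \<Rightarrow> real \<Rightarrow> real" where
  "sinh_quotient y x = (if y = 0 then 2 * x else sinh (2 * y * x) / y)"

end

theory Submission
  imports Defs
begin

text \<open>Two integrations by parts turn \<open>\<integral> K(x,t) exp (\<i> \<omega> t) dt\<close> into boundary terms minus
  \<open>\<omega>\<^sup>-\<^sup>2 \<integral> K\<^sub>2\<^sub>2(x,t) exp (\<i> \<omega> t) dt\<close>. The boundary values of \<open>K\<close> are given; those of
  its \<open>t\<close>-derivative at \<open>t = x\<close> and \<open>t = -x\<close> are \<open>q(x)/4 - Q(x)\<^sup>2/8\<close> and \<open>q(0)/4\<close>, which is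
  read off from the integral equation: there the rectangle of integration degenerates to
  a segment. Rodrigues' formula, integrated by parts \<open>n\<close> times, gives the Fourier transform
  of \<open>P\<^sub>n\<close> as a weighted integral whose power series is that of \<open>j\<^sub>n\<close>, so the partial sums
  of the series are the Fourier transforms of the partial sums of the Fourier-Legendre
  expansion of \<open>K\<^sub>2\<^sub>2\<close>. The Cauchy-Schwarz inequality then bounds the error by \<open>\<epsilon>\<^sub>N(x)\<close>, and
  Weierstrass approximation gives \<open>\<epsilon>\<^sub>N(x) \<rightarrow> 0\<close>, hence locally uniform convergence in \<open>\<omega>\<close>.\<close>

section \<open>Legendre polynomials\<close>

lemma power_dvd_pderiv:
  fixes p r :: "real poly"
  assumes "p ^ Suc k dvd r"
  shows "p ^ k dvd pderiv r"
proof -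
  obtain s where r: "r = p ^ Suc k * s" using assms by (elim dvdE)
  have "pderiv r = p ^ k * (smult (of_nat (Suc k)) (pderiv p) * s + p * pderiv s)"
    unfolding r pderiv_mult pderiv_power_Suc by (simp add: algebra_simps)
  then show ?thesis by (rule dvdI)
qed

text \<open>Each differentiation costs at most one factor \<open>p\<close>. For p = s^2 - 1 this
  makes all derivatives of p^n of order below \<open>n\<close> vanish at both ends of
  [-1, 1].\<close>

lemma power_dvd_higher_pderiv:
  fixes p :: "real poly"
  assumes "m \<le> n"
  shows "p ^ (n - m) dvd (pderiv ^^ m) (p ^ n)"
  using assms
proof (induction m)
  case (Suc m)
  then have "p ^ Suc (n - Suc m) dvd (pderiv ^^ m) (p ^ n)"
    by (simp add: Suc_diff_Suc del: power_Suc)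
  then show ?case using power_dvd_pderiv by simp
qed simp

text \<open>Each integration by parts moves one derivative from the polynomial to \<open>g\<close>
  and changes the sign; the boundary terms vanish because a factor s^2 - 1 survives the first n - 1
  derivatives. The sequence \<open>g i\<close> lists a function with its successive derivatives, so
  the induction hypothesis can be applied to the shifted sequence.\<close>

lemma has_integral_higher_pderiv:
  fixes g :: "nat \<Rightarrow> real \<Rightarrow> 'a::euclidean_space"
  assumes "m \<le> n"
    and g: "\<And>i s. (g i has_vector_derivative g (Suc i) s) (at s)"
  shows "((\<lambda>s. poly ((pderiv ^^ m) ([:-1, 0, 1:] ^ n)) s *\<^sub>R g 0 s) has_integral
           (-1) ^ m *\<^sub>R integral {-1..1} (\<lambda>s. poly ([:-1, 0, 1:] ^ n) s *\<^sub>R g m s)) {-1..1}"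
  using assms
proof (induction m arbitrary: g)
  case 0
  have "continuous_on {-1..1} (g 0)"
    using 0(2) has_vector_derivative_continuous by (fast intro: continuous_at_imp_continuous_on)
  then show ?case
    by (auto intro!: integrable_integral integrable_continuous_real continuous_intros)
next
  case (Suc m)
  let ?W = "[:-1, 0, 1:] ^ n :: real poly"
  have "[:-1, 0, 1::real:] dvd [:-1, 0, 1:] ^ (n - m)"
    using Suc.prems by simp
  then have "[:-1, 0, 1:] dvd (pderiv ^^ m) ?W"
    using power_dvd_higher_pderiv[of m n "[:-1, 0, 1:]"] Suc.prems dvd_trans by fastforce
  then obtain r where r: "(pderiv ^^ m) ?W = [:-1, 0, 1:] * r" by (elim dvdE)
  have ends: "poly ((pderiv ^^ m) ?W) 1 = 0" "poly ((pderiv ^^ m) ?W) (-1) = 0"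
    unfolding r by simp_all
  have cont: "continuous_on {-1..1} (g 0)"
    using Suc.prems(2) has_vector_derivative_continuous by (fast intro: continuous_at_imp_continuous_on)
  have IH: "((\<lambda>s. poly ((pderiv ^^ m) ?W) s *\<^sub>R g (Suc 0) s) has_integral
           (-1) ^ m *\<^sub>R integral {-1..1} (\<lambda>s. poly ?W s *\<^sub>R g (Suc m) s)) {-1..1}"
    using Suc.IH[of "\<lambda>i. g (Suc i)"] Suc.prems by simp
  have "((\<lambda>s. poly (pderiv ((pderiv ^^ m) ?W)) s *\<^sub>R g 0 s) has_integral
           (-1) ^ Suc m *\<^sub>R integral {-1..1} (\<lambda>s. poly ?W s *\<^sub>R g (Suc m) s)) {-1..1}"
  proof (rule integration_by_parts[OF bounded_bilinear_scaleR])
    show "(poly ((pderiv ^^ m) ?W) has_vector_derivative poly (pderiv ((pderiv ^^ m) ?W)) x) (at x)" for x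
      using poly_DERIV has_real_derivative_iff_has_vector_derivative by blast
    show "(g 0 has_vector_derivative g (Suc 0) x) (at x)" for x using Suc.prems(2) .
  qed (use IH ends cont in \<open>auto intro!: continuous_intros\<close>)
  then show ?case by simp
qed

text \<open>All \<open>n\<close> derivatives in Rodrigues' formula are moved to \<open>g 0\<close>,
  and the sign (-1)^n turns (s^2 - 1)^n into (1 - s^2)^n. With \<open>g\<close> the derivatives of a
  polynomial this yields orthogonality and norms, with \<open>g\<close> those of an exponential the
  Fourier transform.\<close>

lemma legendre_P_has_integral:
  fixes g :: "nat \<Rightarrow> real \<Rightarrow> 'a::euclidean_space"
  assumes g: "\<And>i s. (g i has_vector_derivative g (Suc i) s) (at s)"
  shows "((\<lambda>s. legendre_P n s *\<^sub>R g 0 s) has_integral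
           (1 / (2 ^ n * fact n)) *\<^sub>R integral {-1..1} (\<lambda>s. (1 - s\<^sup>2) ^ n *\<^sub>R g n s)) {-1..1}"
proof -
  have 1: "((\<lambda>s. (1 / (2 ^ n * fact n)) *\<^sub>R (poly ((pderiv ^^ n) ([:-1, 0, 1:] ^ n)) s *\<^sub>R g 0 s)) has_integral
      (1 / (2 ^ n * fact n)) *\<^sub>R (-1) ^ n *\<^sub>R integral {-1..1} (\<lambda>s. poly ([:-1, 0, 1:] ^ n) s *\<^sub>R g n s)) {-1..1}"
    by (intro has_integral_cmul has_integral_higher_pderiv g) simp
  have 2: "(-1) ^ n *\<^sub>R integral {-1..1} (\<lambda>s. poly ([:-1, 0, 1:] ^ n) s *\<^sub>R g n s)
      = integral {-1..1} (\<lambda>s. (1 - s\<^sup>2) ^ n *\<^sub>R g n s)"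
  proof -
    have "(-1) ^ n * poly ([:-1, 0, 1:] ^ n) s = (1 - s\<^sup>2) ^ n" for s :: real
      by (simp add: poly_power power2_eq_square flip: power_mult_distrib)
    then show ?thesis
      unfolding integral_cmul[symmetric] scaleR_scaleR by (simp only:)
  qed
  from 1 show ?thesis
    unfolding 2 by (simp add: legendre_P_def legendre_poly_def)
qed

section \<open>Moments of the weight (1 - s^2)^n and half-integer Gamma values\<close>

lemma has_integral_power_symmetric:
  "((\<lambda>s::real. s ^ k) has_integral (1 - (-1) ^ Suc k) / Suc k) {-1..1}"
proof -
  have "((\<lambda>s::real. s ^ k) has_integral (1 ^ Suc k / Suc k - (-1) ^ Suc k / Suc k)) {-1..1}"
  proof (intro fundamental_theorem_of_calculus)
    fix x :: real
    have "((\<lambda>s. s ^ Suc k / Suc k) has_real_derivative Suc k * x ^ k / Suc k) (at x within {-1..1})"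
      using DERIV_power_Suc[of "\<lambda>s. s" 1 x "{-1..1}" k]
      by (intro DERIV_cdivide) simp
    then show "((\<lambda>s. s ^ Suc k / Suc k) has_vector_derivative x ^ k) (at x within {-1..1})"
      by (simp add: has_real_derivative_iff_has_vector_derivative del: of_nat_Suc power_Suc)
  qed simp
  then show ?thesis by (simp add: diff_divide_distrib add_divide_distrib)
qed

lemma Gamma_half_plus1: "Gamma (real k + 3 / 2) = (real k + 1 / 2) * Gamma (real k + 1 / 2)"
proof -
  have "real k + 1 / 2 + 1 = real k + 3 / 2" "real k + 1 / 2 > 0" by simp_all
  then show ?thesis using Gamma_plus1[of "real k + 1 / 2"] by (metis less_irrefl nonpos_Ints_nonpos not_le)
qed

lemma Gamma_half_nonzero: "Gamma (real k + 1 / 2) \<noteq> 0"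
proof -
  have "Gamma (real k + 1 / 2) > 0" by (intro Gamma_real_pos) simp
  then show ?thesis by (metis less_irrefl)
qed

text \<open>This is the Beta integral B(k + 1/2, n + 1), as the substitution of s^2 shows. The proof
  avoids the substitution: expanding one factor 1 - s^2 expresses the moment for n + 1 through those
  for \<open>n\<close> at \<open>k\<close> and k + 1, hence the generalisation over
  \<open>k\<close>.\<close>

lemma has_integral_moment_even:
  "((\<lambda>s::real. (1 - s\<^sup>2) ^ n * s ^ (2 * k)) has_integral
      fact n * Gamma (k + 1 / 2) / Gamma (k + n + 3 / 2)) {-1..1}"
proof (induction n arbitrary: k)
  case 0
  have "2 / (1 + 2 * real k) = 1 / (real k + 1 / 2)" by (simp add: divide_simps)
  then have "(1 - (-1) ^ Suc (2 * k)) / Suc (2 * k) = fact 0 * Gamma (k + 1 / 2) / Gamma (k + (0::nat) + 3 / 2)"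
    by (simp add: Gamma_half_plus1 Gamma_half_nonzero)
  then show ?case using has_integral_power_symmetric[of "2 * k"] by simp
next
  case (Suc n)
  define A where "A = Gamma (real k + 1 / 2)"
  define B where "B = Gamma (real k + n + 3 / 2)"
  have "B > 0" unfolding B_def by (intro Gamma_real_pos) simp
  have G1: "Gamma (real (Suc k) + 1 / 2) = (real k + 1 / 2) * A"
    using Gamma_half_plus1[of k] unfolding A_def by (simp add: add_ac)
  have G2: "Gamma (real (Suc k) + n + 3 / 2) = (real k + n + 3 / 2) * B"
    using Gamma_half_plus1[of "Suc (k + n)"] unfolding B_def by (simp add: add_ac)
  have "((\<lambda>s::real. (1 - s\<^sup>2) ^ n * s ^ (2 * k) - (1 - s\<^sup>2) ^ n * s ^ (2 * Suc k)) has_integral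
      fact n * A / B - fact n * ((real k + 1 / 2) * A) / ((real k + n + 3 / 2) * B)) {-1..1}"
    unfolding A_def B_def G1[unfolded A_def, symmetric] G2[unfolded B_def, symmetric]
    using has_integral_diff[OF Suc.IH[of k] Suc.IH[of "Suc k"]] .
  moreover have "fact n * A / B - fact n * ((real k + 1 / 2) * A) / ((real k + n + 3 / 2) * B)
      = fact (Suc n) * A / ((real k + n + 3 / 2) * B)"
  proof -
    define c where "c = real k + n + 3 / 2"
    have "c \<noteq> 0" unfolding c_def by linarith
    then have "fact n * A / B - fact n * ((real k + 1 / 2) * A) / (c * B)
        = fact n * A * (c - (real k + 1 / 2)) / (c * B)"
      using \<open>B > 0\<close> by (simp add: divide_simps) (simp add: algebra_simps)
    also have "c - (real k + 1 / 2) = Suc n" unfolding c_def by simp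
    finally show ?thesis unfolding c_def by (simp add: algebra_simps)
  qed
  moreover have "Gamma (real k + Suc n + 3 / 2) = (real k + n + 3 / 2) * B"
    using G2 by (simp add: add_ac)
  moreover have "(1 - s\<^sup>2) ^ n * s ^ (2 * k) - (1 - s\<^sup>2) ^ n * s ^ (2 * Suc k) = (1 - s\<^sup>2) ^ Suc n * s ^ (2 * k)" for s :: real
    by (simp add: algebra_simps power2_eq_square)
  ultimately show ?case by (simp add: A_def)
qed

text \<open>The integrand is odd; the recursion of the even case brings the claim down to pure odd
  powers.\<close>

lemma has_integral_moment_odd:
  "((\<lambda>s::real. (1 - s\<^sup>2) ^ n * s ^ Suc (2 * k)) has_integral 0) {-1..1}"
proof (induction n arbitrary: k)
  case 0
  then show ?case using has_integral_power_symmetric[of "Suc (2 * k)"] by simp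
next
  case (Suc n)
  have "(1 - s\<^sup>2) ^ n * s ^ Suc (2 * k) - (1 - s\<^sup>2) ^ n * s ^ Suc (2 * Suc k) = (1 - s\<^sup>2) ^ Suc n * s ^ Suc (2 * k)" for s :: real
    by (simp add: algebra_simps power2_eq_square)
  then show ?case
    using has_integral_diff[OF Suc.IH[of k] Suc.IH[of "Suc k"]] by simp
qed

text \<open>Legendre's duplication formula at half-integers. It converts the factorials (2k)! of the
  exponential series into the k! of the Bessel series, and evaluates the norm of the Legendre
  polynomials.\<close>

lemma fact_double_Gamma:
  "fact (2 * k) * sqrt pi = 4 ^ k * fact k * Gamma (real k + 1 / 2)"
proof (induction k)
  case 0
  then show ?case by (simp add: Gamma_one_half_real)
next
  case (Suc k)
  have "Gamma (real (Suc k) + 1 / 2) = (real k + 1 / 2) * Gamma (real k + 1 / 2)"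
    using Gamma_half_plus1[of k] by (simp add: add_ac)
  then have "4 ^ Suc k * fact (Suc k) * Gamma (real (Suc k) + 1 / 2)
      = (2 * real k + 2) * (2 * real k + 1) * (4 ^ k * fact k * Gamma (real k + 1 / 2))"
    by (simp add: algebra_simps)
  also have "\<dots> = fact (2 * Suc k) * sqrt pi"
    unfolding Suc.IH[symmetric] by (simp add: field_simps)
  finally show ?case ..
qed

section \<open>Orthogonality and norms of the Legendre polynomials\<close>

lemma degree_legendre_poly: "degree (legendre_poly n) = n"
  by (simp add: legendre_poly_def degree_higher_pderiv degree_power_eq)

lemma has_integral_legendre_P_mult_poly:
  "((\<lambda>s. legendre_P n s * poly p s) has_integral
     integral {-1..1} (\<lambda>s. (1 - s\<^sup>2) ^ n * poly ((pderiv ^^ n) p) s) / (2 ^ n * fact n)) {-1..1}"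
proof -
  have "(poly ((pderiv ^^ i) p) has_vector_derivative poly ((pderiv ^^ Suc i) p) s) (at s)" for i s
    using poly_DERIV has_real_derivative_iff_has_vector_derivative by fastforce
  from legendre_P_has_integral[of "\<lambda>i. poly ((pderiv ^^ i) p)", OF this, of n] show ?thesis
    by simp
qed

text \<open>After \<open>n\<close> integrations by parts the integrand contains the
  \<open>n\<close>-th derivative of \<open>p\<close>, which is zero.\<close>

lemma legendre_P_orthogonal_poly:
  assumes "degree p < n"
  shows "integral {-1..1} (\<lambda>s. legendre_P n s * poly p s) = 0"
proof -
  have "coeff ((pderiv ^^ n) p) i = 0" for i
    using assms by (simp add: coeff_higher_pderiv coeff_eq_0)
  then have "(pderiv ^^ n) p = 0" by (simp add: poly_eq_iff)
  then show ?thesis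
    using has_integral_legendre_P_mult_poly[of n p] by (simp add: integral_unique)
qed

lemma legendre_P_orthogonal:
  assumes "m \<noteq> n"
  shows "integral {-1..1} (\<lambda>s. legendre_P m s * legendre_P n s) = 0"
proof (cases "m < n")
  case True
  then show ?thesis
    using legendre_P_orthogonal_poly[of "legendre_poly m" n]
    by (simp add: degree_legendre_poly mult.commute flip: legendre_P_def)
next
  case False
  then show ?thesis
    using legendre_P_orthogonal_poly[of "legendre_poly n" m] assms
    by (simp add: degree_legendre_poly flip: legendre_P_def)
qed

text \<open>Together with Rodrigues' formula this takes 2n derivatives of a monic polynomial of
  degree 2n. It serves both to compute the norm and to see that \<open>legendre_poly n\<close> is
  not zero.\<close>

lemma higher_pderiv_legendre_poly:
  "(pderiv ^^ n) (legendre_poly n) = [:fact (2 * n) / (2 ^ n * fact n):]"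
proof -
  define W :: "real poly" where "W = [:-1, 0, 1:] ^ n"
  have "degree W = 2 * n"
    unfolding W_def by (simp add: degree_power_eq)
  moreover have "lead_coeff W = 1"
    unfolding W_def lead_coeff_power by simp
  ultimately have "degree W = 2 * n" "coeff W (2 * n) = 1" by simp_all
  then have "coeff ((pderiv ^^ (2 * n)) W) 0 = fact (2 * n)"
    by (simp add: coeff_higher_pderiv pochhammer_fact)
  moreover have "degree ((pderiv ^^ (2 * n)) W) = 0"
    using \<open>degree W = 2 * n\<close> by (simp add: degree_higher_pderiv)
  ultimately have "(pderiv ^^ (2 * n)) W = [:fact (2 * n):]"
    by (metis degree_eq_zeroE coeff_pCons_0)
  then show ?thesis
    unfolding legendre_poly_def W_def[symmetric] higher_pderiv_smult
    by (simp add: mult_2 funpow_add)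
qed

text \<open>Integrating by parts against the polynomial itself leaves a constant times the zeroth
  moment of the weight; duplication reduces the result to the Gamma quotient 1 / (n + 1/2).\<close>

lemma legendre_P_square_integral:
  "integral {-1..1} (\<lambda>s. legendre_P n s * legendre_P n s) = 2 / (2 * real n + 1)"
proof -
  have "integral {-1..1} (\<lambda>s::real. (1 - s\<^sup>2) ^ n) = fact n * sqrt pi / Gamma (n + 3 / 2)"
    using has_integral_moment_even[of n 0] by (simp add: integral_unique Gamma_one_half_real)
  moreover have "integral {-1..1} (\<lambda>s. legendre_P n s * legendre_P n s)
      = integral {-1..1} (\<lambda>s::real. (1 - s\<^sup>2) ^ n * (fact (2 * n) / (2 ^ n * fact n))) / (2 ^ n * fact n)"
    using has_integral_legendre_P_mult_poly[of n "legendre_poly n"]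
    by (simp add: integral_unique higher_pderiv_legendre_poly flip: legendre_P_def)
  ultimately have "integral {-1..1} (\<lambda>s. legendre_P n s * legendre_P n s)
      = fact n * (fact (2 * n) * sqrt pi) / (Gamma (n + 3 / 2) * (4 ^ n * fact n * fact n))"
    by (simp add: field_simps flip: power_mult_distrib)
  also have "\<dots> = Gamma (n + 1 / 2) / Gamma (n + 3 / 2)"
    unfolding fact_double_Gamma by simp
  also have "\<dots> = 2 / (2 * real n + 1)"
  proof -
    have "Gamma (n + 1 / 2) / Gamma (n + 3 / 2) = 1 / (real n + 1 / 2)"
      unfolding Gamma_half_plus1 by (simp add: Gamma_half_nonzero)
    also have "\<dots> = 2 / (2 * real n + 1)" by (simp add: divide_simps)
    finally show ?thesis .
  qed
  finally show ?thesis .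
qed

section \<open>Fourier transform of the Legendre polynomials\<close>

text \<open>The integral is Poisson's integral for the Bessel function of order n + 1/2, up to a
  prefactor. The exponential series is integrated term by term, and only its even powers have
  nonzero moments.\<close>

lemma fourier_weight_sums:
  "(\<lambda>k. (-1) ^ k * z ^ (2 * k) / fact (2 * k)
      * of_real (fact n * Gamma (real k + 1 / 2) / Gamma (real k + n + 3 / 2)))
    sums integral {-1..1} (\<lambda>s. of_real ((1 - s\<^sup>2) ^ n) * exp (\<i> * z * of_real s))"
proof -
  define f where "f = (\<lambda>j s. of_real ((1 - s\<^sup>2) ^ n) * ((\<i> * z * of_real s) ^ j /\<^sub>R fact j))"
  define I where "I = (\<lambda>s. of_real ((1 - s\<^sup>2) ^ n) * exp (\<i> * z * of_real s))"
  have fsums: "(\<lambda>j. f j s) sums I s" for s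
    unfolding f_def I_def using exp_converges by (rule sums_mult)
  \<comment> \<open>Uniform convergence justifies termwise integration. The majorant is the
    exponential series at \<open>norm z\<close>, since neither s nor 1 - s^2 exceeds 1 in absolute
    value.\<close>
  have "uniform_limit {-1..1} (\<lambda>N s. \<Sum>j<N. f j s) (\<lambda>s. suminf (\<lambda>j. f j s)) sequentially"
  proof (rule Weierstrass_m_test)
    show "norm (f j s) \<le> norm z ^ j /\<^sub>R fact j" if s: "s \<in> {-1..1}" for j s
    proof -
      have "\<bar>s\<bar> \<le> 1" using s by auto
      then have "s\<^sup>2 \<le> 1" by (simp add: abs_square_le_1)
      have "\<bar>1 - s\<^sup>2\<bar> \<le> 1" using \<open>s\<^sup>2 \<le> 1\<close> zero_le_power2[of s] by linarith
      then have 1: "\<bar>1 - s\<^sup>2\<bar> ^ n \<le> 1" by (simp add: power_le_one)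
      have "norm z * \<bar>s\<bar> \<le> norm z"
        using \<open>\<bar>s\<bar> \<le> 1\<close> by (simp add: mult_left_le)
      then have "(norm z * \<bar>s\<bar>) ^ j \<le> norm z ^ j" by (intro power_mono) auto
      then have "\<bar>1 - s\<^sup>2\<bar> ^ n * ((norm z * \<bar>s\<bar>) ^ j /\<^sub>R fact j) \<le> 1 * (norm z ^ j /\<^sub>R fact j)"
        using 1 by (intro mult_mono) (auto simp: divide_right_mono field_simps)
      then show ?thesis
        unfolding f_def norm_mult norm_scaleR norm_power norm_of_real by (simp add: power_abs)
    qed
  qed (use summable_exp_generic[of "norm z"] in simp)
  moreover have "(\<lambda>s. suminf (\<lambda>j. f j s)) = I" by (intro ext sums_unique[symmetric] fsums)
  ultimately have lim: "uniform_limit {-1..1} (\<lambda>N s. \<Sum>j<N. f j s) I sequentially" by simp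
  have contf: "continuous_on {-1..1} (\<lambda>s. \<Sum>j<N. f j s)" for N
    unfolding f_def by (intro continuous_intros)
  from lim contf obtain L J where LJ: "\<And>N. ((\<lambda>s. \<Sum>j<N. f j s) has_integral L N) {-1..1}"
      "(I has_integral J) {-1..1}" "L \<longlonglongrightarrow> J"
    by (rule uniform_limit_integral) auto
  have moment: "(f j has_integral (\<i> * z) ^ j / fact j * of_real m) {-1..1}"
    if "((\<lambda>s::real. (1 - s\<^sup>2) ^ n * s ^ j) has_integral m) {-1..1}" for j m
  proof -
    have "((\<lambda>s. (\<i> * z) ^ j / fact j * of_real ((1 - s\<^sup>2) ^ n * s ^ j)) has_integral
        (\<i> * z) ^ j / fact j * of_real m) {-1..1}"
      using has_integral_linear[OF that bounded_linear_of_real]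
      by (intro has_integral_mult_right) (simp add: o_def)
    moreover have "f j = (\<lambda>s. (\<i> * z) ^ j / fact j * of_real ((1 - s\<^sup>2) ^ n * s ^ j))"
      unfolding f_def by (auto simp: power_mult_distrib scaleR_conv_of_real divide_inverse mult_ac)
    ultimately show ?thesis by simp
  qed
  define c where "c = (\<lambda>j. integral {-1..1} (f j))"
  have "f j integrable_on {-1..1}" for j
    unfolding f_def by (intro integrable_continuous_real continuous_intros)
  then have "((\<lambda>s. \<Sum>j<N. f j s) has_integral (\<Sum>j<N. c j)) {-1..1}" for N
    unfolding c_def by (intro has_integral_sum integrable_integral) auto
  then have "L = (\<lambda>N. \<Sum>j<N. c j)" using LJ(1) has_integral_unique by blast
  then have "c sums J" using LJ(3) by (simp add: sums_def)
  \<comment> \<open>The odd moments vanish, so the sum may be reindexed over the even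
    exponents.\<close>
  moreover have "c j = 0" if "j \<notin> range ((*) 2)" for j
  proof -
    have "odd j" using that by (auto elim!: evenE)
    then obtain k where "j = Suc (2 * k)" by (auto elim!: oddE)
    then show ?thesis
      unfolding c_def using moment[OF has_integral_moment_odd[of n k]] by (simp add: integral_unique)
  qed
  moreover have "strict_mono ((*) (2::nat))" by (simp add: strict_mono_def)
  ultimately have "(\<lambda>k. c (2 * k)) sums J"
    using sums_mono_reindex[of "(*) 2" c J] by auto
  moreover have "c (2 * k) = (-1) ^ k * z ^ (2 * k) / fact (2 * k)
      * of_real (fact n * Gamma (real k + 1 / 2) / Gamma (real k + n + 3 / 2))" for k
  proof -
    have "(\<i> * z) ^ (2 * k) = (-1) ^ k * z ^ (2 * k)"
      by (simp add: power_mult_distrib power_mult) (rule power_minus)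
    then show ?thesis
      unfolding c_def using moment[OF has_integral_moment_even[of n k]]
      by (simp only: integral_unique)
  qed
  ultimately show ?thesis
    using LJ(2) unfolding I_def by (simp add: integral_unique)
qed

lemma legendre_P_0: "legendre_P 0 s = 1"
  by (simp add: legendre_P_def legendre_poly_def)

text \<open>The positive real factor 1/2 can be split off the principal power without crossing the
  branch cut, and what remains is exactly \<open>csqrt z\<close>. The quotient is therefore a
  monomial on the whole punctured plane, the negative axis included.\<close>

lemma powr_half_divide_csqrt:
  assumes "z \<noteq> 0"
  shows "(z / 2) powr (of_nat n + 1 / 2) / csqrt z = (z / 2) ^ n / of_real (sqrt 2)"
proof -
  have "(1 / 2 * z) powr (1 / 2) = (1 / 2) powr (1 / 2) * z powr (1 / 2)"
    by (rule powr_times_real_left) auto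
  moreover have "(1 / 2 :: complex) powr (1 / 2) = of_real (1 / sqrt 2)"
    using powr_of_real[of "1 / 2" "1 / 2"] by (simp add: powr_half_sqrt real_sqrt_divide)
  ultimately have "(z / 2) powr (1 / 2) = csqrt z / of_real (sqrt 2)"
    by (simp add: csqrt_conv_powr)
  moreover have "(z / 2) powr of_nat n = (z / 2) ^ n"
    using assms by (simp add: powr_nat')
  ultimately show ?thesis
    using assms by (simp add: powr_add)
qed

text \<open>Rodrigues' formula gives (i z)^n / (2^n n!) times Poisson's integral \<open>S\<close>,
  whose series agrees term by term with the Bessel series \<open>T\<close> up to the factor n!
  sqrt(pi).\<close>

lemma legendre_P_fourier:
  "((\<lambda>s. of_real (legendre_P n s) * exp (\<i> * z * of_real s)) has_integral
      2 * \<i> ^ n * spherical_bessel_j n z) {-1..1}"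
proof (cases "z = 0")
  case True
  \<comment> \<open>At \<open>z = 0\<close> the exponential is 1, and orthogonality to constants
    matches the values 1 and 0 assigned to \<open>spherical_bessel_j\<close> there.\<close>
  have "((\<lambda>s. legendre_P n s * poly 1 s) has_integral integral {-1..1} (\<lambda>s. legendre_P n s * poly 1 s)) {-1..1}"
    unfolding legendre_P_def
    by (intro integrable_integral integrable_continuous_real continuous_intros)
  moreover have "integral {-1..1} (\<lambda>s. legendre_P n s * poly 1 s) = (if n = 0 then 2 else 0)"
    using legendre_P_orthogonal_poly[of 1 n] by (simp add: legendre_P_0)
  ultimately have "((of_real \<circ> legendre_P n) has_integral complex_of_real (if n = 0 then 2 else 0)) {-1..1}"
    by (intro has_integral_linear[OF _ bounded_linear_of_real]) simp
  then show ?thesis using True by (simp add: spherical_bessel_j_def o_def split: if_splits)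
next
  case False
  have deriv: "((\<lambda>s. (\<i> * z) ^ m * exp (\<i> * z * of_real s)) has_vector_derivative
      (\<i> * z) ^ Suc m * exp (\<i> * z * of_real s)) (at s)" for m s
    by (auto intro!: derivative_eq_intros has_vector_derivative_real_field simp: algebra_simps)
  define S where "S = integral {-1..1} (\<lambda>s. of_real ((1 - s\<^sup>2) ^ n) * exp (\<i> * z * of_real s))"
  define T where "T = (\<lambda>k. (-1) ^ k / fact k * rGamma (of_nat k + (of_nat n + 1 / 2) + 1) * (z / 2) ^ (2 * k))"
  \<comment> \<open>By duplication the quotient of Gamma(k + 1/2) and (2k)! is sqrt(pi) / (4^k k!),
    and the power 4^k turns z^(2k) into (z/2)^(2k).\<close>
  have summand: "(-1) ^ k * z ^ (2 * k) / fact (2 * k)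
      * of_real (fact n * Gamma (real k + 1 / 2) / Gamma (real k + n + 3 / 2))
      = fact n * of_real (sqrt pi) * T k" for k
  proof -
    have arg: "of_nat k + (of_nat n + 1 / 2) + 1 = complex_of_real (real k + n + 3 / 2)"
      by simp
    have rG: "rGamma (of_nat k + (of_nat n + 1 / 2) + 1) = complex_of_real (1 / Gamma (real k + n + 3 / 2))"
      unfolding arg rGamma_inverse_Gamma inverse_eq_divide Gamma_complex_of_real by (simp only: of_real_divide of_real_1)
    have "Gamma (real k + 1 / 2) / fact (2 * k) = sqrt pi / (4 ^ k * fact k)"
      using fact_double_Gamma[of k] by (simp add: field_simps)
    then have "complex_of_real (Gamma (real k + 1 / 2) / fact (2 * k)) = of_real (sqrt pi / (4 ^ k * fact k))"
      by (rule arg_cong)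
    then have G: "complex_of_real (Gamma (real k + 1 / 2)) / fact (2 * k) = of_real (sqrt pi) / (4 ^ k * fact k)"
      by (simp only: of_real_divide of_real_fact of_real_mult of_real_numeral of_real_power)
    have "(-1) ^ k * z ^ (2 * k) / fact (2 * k) * of_real (fact n * Gamma (real k + 1 / 2) / Gamma (real k + n + 3 / 2))
        = (-1) ^ k * z ^ (2 * k) * fact n * (of_real (Gamma (real k + 1 / 2)) / fact (2 * k)) * of_real (1 / Gamma (real k + n + 3 / 2))"
      by (simp only: of_real_divide of_real_fact of_real_mult of_real_1 divide_inverse mult_ac mult_1_left)
    also have "\<dots> = fact n * of_real (sqrt pi) * T k"
    proof -
      have "(z / 2) ^ (2 * k) = z ^ (2 * k) / 4 ^ k" by (simp add: power_divide power_mult)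
      then show ?thesis unfolding T_def rG G by (simp only: divide_inverse inverse_mult_distrib mult_ac)
    qed
    finally show ?thesis .
  qed
  have "(\<lambda>k. fact n * of_real (sqrt pi) * T k) sums S"
    using fourier_weight_sums[of z n] unfolding summand S_def .
  then have "(\<lambda>k. fact n * of_real (sqrt pi) * T k / (fact n * of_real (sqrt pi))) sums (S / (fact n * of_real (sqrt pi)))"
    by (rule sums_divide)
  then have "suminf T = S / (fact n * of_real (sqrt pi))"
    by (simp add: sums_unique[symmetric])
  then have S: "S = fact n * of_real (sqrt pi) * suminf T" by simp
  have "of_real (sqrt (pi / 2)) / csqrt z * (z / 2) powr (of_nat n + 1 / 2)
      = of_real (sqrt (pi / 2)) * ((z / 2) powr (of_nat n + 1 / 2) / csqrt z)"
    by simp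
  also have "\<dots> = of_real (sqrt (pi / 2) / sqrt 2) * (z / 2) ^ n"
    unfolding powr_half_divide_csqrt[OF False] by simp
  also have "sqrt (pi / 2) / sqrt 2 = sqrt pi / 2"
    by (simp add: real_sqrt_divide)
  finally have prefactor: "of_real (sqrt (pi / 2)) / csqrt z * (z / 2) powr (of_nat n + 1 / 2)
      = of_real (sqrt pi / 2) * (z / 2) ^ n" .
  have "spherical_bessel_j n z = (of_real (sqrt (pi / 2)) / csqrt z * (z / 2) powr (of_nat n + 1 / 2)) * suminf T"
    using False by (simp only: spherical_bessel_j_def bessel_J_def T_def if_False mult.assoc)
  then have j: "spherical_bessel_j n z = of_real (sqrt pi) / 2 * (z / 2) ^ n * suminf T"
    unfolding prefactor by simp
  have "((\<lambda>s. legendre_P n s *\<^sub>R exp (\<i> * z * of_real s)) has_integral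
      (1 / (2 ^ n * fact n)) *\<^sub>R integral {-1..1} (\<lambda>s. (1 - s\<^sup>2) ^ n *\<^sub>R ((\<i> * z) ^ n * exp (\<i> * z * of_real s)))) {-1..1}"
    using legendre_P_has_integral[of "\<lambda>m s. (\<i> * z) ^ m * exp (\<i> * z * of_real s)" n, OF deriv] by simp
  moreover have "integral {-1..1} (\<lambda>s. (1 - s\<^sup>2) ^ n *\<^sub>R ((\<i> * z) ^ n * exp (\<i> * z * of_real s))) = (\<i> * z) ^ n * S"
  proof -
    have "(1 - s\<^sup>2) ^ n *\<^sub>R ((\<i> * z) ^ n * exp (\<i> * z * of_real s))
        = (\<i> * z) ^ n * (of_real ((1 - s\<^sup>2) ^ n) * exp (\<i> * z * of_real s))" for s
      unfolding scaleR_conv_of_real by (rule mult.left_commute)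
    then show ?thesis unfolding S_def by simp
  qed
  moreover have "(1 / (2 ^ n * fact n)) *\<^sub>R ((\<i> * z) ^ n * S) = 2 * \<i> ^ n * spherical_bessel_j n z"
    unfolding S j by (simp add: scaleR_conv_of_real field_simps power_mult_distrib)
  ultimately show ?thesis by (simp add: scaleR_conv_of_real)
qed

section \<open>Mean square convergence of Fourier-Legendre expansions\<close>

text \<open>The choice of \<open>c\<close> makes the remainder orthogonal to each Legendre
  polynomial up to order \<open>N\<close>; these span the polynomials of degree at most
  \<open>N\<close>, as removing leading terms one at a time shows.\<close>

lemma legendre_partial_sum_orthogonal:
  fixes f :: "real \<Rightarrow> real"
  defines "c \<equiv> \<lambda>n. (2 * real n + 1) / 2 * integral {-1..1} (\<lambda>s. f s * legendre_P n s)"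
  assumes f: "continuous_on {-1..1} f" and "degree p \<le> N"
  shows "integral {-1..1} (\<lambda>s. (f s - (\<Sum>n\<le>N. c n * legendre_P n s)) * poly p s) = 0"
proof -
  define S where "S = (\<lambda>s. \<Sum>n\<le>N. c n * legendre_P n s)"
  have contP: "continuous_on {-1..1} (legendre_P n)" for n
    unfolding legendre_P_def by (intro continuous_intros)
  have contS: "continuous_on {-1..1} S" unfolding S_def by (intro continuous_intros contP)
  have int: "(\<lambda>s. (f s - S s) * poly r s) integrable_on {-1..1}" for r
    by (intro integrable_continuous_real continuous_intros f contS)
  have basis: "integral {-1..1} (\<lambda>s. (f s - S s) * legendre_P m s) = 0" if "m \<le> N" for m
  proof -
    have "integral {-1..1} (\<lambda>s. S s * legendre_P m s)
        = (\<Sum>n\<le>N. c n * integral {-1..1} (\<lambda>s. legendre_P n s * legendre_P m s))"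
      unfolding S_def sum_distrib_right mult.assoc
      by (subst integral_sum) (auto intro!: integrable_continuous_real continuous_intros contP)
    also have "\<dots> = (\<Sum>n\<le>N. if n = m then c m * (2 / (2 * real m + 1)) else 0)"
      by (intro sum.cong) (auto simp: legendre_P_orthogonal legendre_P_square_integral)
    also have "\<dots> = integral {-1..1} (\<lambda>s. f s * legendre_P m s)"
      using that by (simp add: c_def)
    finally show ?thesis
      unfolding left_diff_distrib
      by (subst integral_diff) (auto intro!: integrable_continuous_real continuous_intros contP contS f)
  qed
  \<comment> \<open>Requiring the coefficients from \<open>d\<close> on to vanish, rather than
    bounding the degree, makes \<open>d = 0\<close> the case of the zero polynomial.\<close>
  have "integral {-1..1} (\<lambda>s. (f s - S s) * poly r s) = 0"
    if "\<forall>i\<ge>d. coeff r i = 0" "d \<le> Suc N" for r d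
    using that
  proof (induction d arbitrary: r)
    case 0
    then have "r = 0" by (simp add: poly_eq_iff)
    then show ?case by simp
  next
    case (Suc d)
    have lc: "coeff (legendre_poly d) d \<noteq> 0"
      using higher_pderiv_legendre_poly[of d] degree_legendre_poly[of d]
      by (cases "legendre_poly d = 0") (use leading_coeff_0_iff in fastforce)+
    define a where "a = coeff r d / coeff (legendre_poly d) d"
    define t where "t = r - smult a (legendre_poly d)"
    have "coeff t i = 0" if "i \<ge> d" for i
    proof (cases "i = d")
      case False
      then show ?thesis
        using that Suc.prems(1) by (simp add: t_def coeff_eq_0 degree_legendre_poly)
    qed (use lc in \<open>simp add: t_def a_def\<close>)
    then have t: "integral {-1..1} (\<lambda>s. (f s - S s) * poly t s) = 0"
      using Suc by simp
    have "(f s - S s) * poly r s = (f s - S s) * poly t s + a * ((f s - S s) * legendre_P d s)" for s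
      by (simp add: t_def legendre_P_def algebra_simps)
    moreover have "integral {-1..1} (\<lambda>s. (f s - S s) * poly t s + a * ((f s - S s) * legendre_P d s)) = 0"
      using t basis[of d] Suc.prems(2) int[of t] int[of "legendre_poly d"]
      unfolding legendre_P_def
      by (subst integral_add) (auto intro!: integrable_continuous_real continuous_intros f contS)
    ultimately show ?case by simp
  qed
  from this[of "Suc N" p] show ?thesis
    using assms(3) unfolding S_def by (simp add: coeff_eq_0)
qed

text \<open>Pythagoras: split f - p into f - S and S - p. The second part has degree at most
  \<open>N\<close>, so it is orthogonal to the first.\<close>

lemma legendre_partial_sum_best_approximation:
  fixes f :: "real \<Rightarrow> real"
  defines "c \<equiv> \<lambda>n. (2 * real n + 1) / 2 * integral {-1..1} (\<lambda>s. f s * legendre_P n s)"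
  assumes f: "continuous_on {-1..1} f" and "degree p \<le> N"
  shows "integral {-1..1} (\<lambda>s. (f s - (\<Sum>n\<le>N. c n * legendre_P n s))\<^sup>2)
    \<le> integral {-1..1} (\<lambda>s. (f s - poly p s)\<^sup>2)"
proof -
  define S where "S = (\<Sum>n\<le>N. smult (c n) (legendre_poly n))"
  have S: "(\<Sum>n\<le>N. c n * legendre_P n s) = poly S s" for s
    unfolding S_def by (simp add: poly_sum legendre_P_def)
  have "degree S \<le> N"
    unfolding S_def by (intro degree_sum_le) (auto intro: order_trans[OF degree_smult_le] simp: degree_legendre_poly)
  then have "degree (S - p) \<le> N" using assms(3) by (rule degree_diff_le)
  then have cross: "integral {-1..1} (\<lambda>s. (f s - poly S s) * poly (S - p) s) = 0"
    using legendre_partial_sum_orthogonal[OF f, of "S - p" N] S unfolding c_def by simp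
  have eq: "(f s - poly p s)\<^sup>2 = (f s - poly S s)\<^sup>2 + ((poly (S - p) s)\<^sup>2 + 2 * ((f s - poly S s) * poly (S - p) s))" for s
    by (simp add: power2_eq_square algebra_simps)
  have "integral {-1..1} (\<lambda>s. (f s - poly p s)\<^sup>2)
      = integral {-1..1} (\<lambda>s. (f s - poly S s)\<^sup>2) + (integral {-1..1} (\<lambda>s. (poly (S - p) s)\<^sup>2)
        + integral {-1..1} (\<lambda>s. 2 * ((f s - poly S s) * poly (S - p) s)))"
  proof -
    have "integral {-1..1} (\<lambda>s. (poly (S - p) s)\<^sup>2 + 2 * ((f s - poly S s) * poly (S - p) s))
        = integral {-1..1} (\<lambda>s. (poly (S - p) s)\<^sup>2) + integral {-1..1} (\<lambda>s. 2 * ((f s - poly S s) * poly (S - p) s))"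
      by (intro integral_add integrable_continuous_real continuous_intros f)
    then show ?thesis unfolding eq
      by (subst integral_add) (auto intro!: integrable_continuous_real continuous_intros f)
  qed
  moreover have "integral {-1..1} (\<lambda>s. (poly (S - p) s)\<^sup>2) \<ge> 0"
    by (intro integral_nonneg integrable_continuous_real continuous_intros) auto
  ultimately show ?thesis using cross unfolding S by simp
qed

text \<open>A uniformly close polynomial exists by Weierstrass; once \<open>N\<close> reaches its
  degree, the partial sum is at least as good in mean square.\<close>

lemma legendre_expansion_L2_real:
  fixes f :: "real \<Rightarrow> real"
  defines "c \<equiv> \<lambda>n. (2 * real n + 1) / 2 * integral {-1..1} (\<lambda>s. f s * legendre_P n s)"
  assumes f: "continuous_on {-1..1} f"
  shows "(\<lambda>N. integral {-1..1} (\<lambda>s. (f s - (\<Sum>n\<le>N. c n * legendre_P n s))\<^sup>2)) \<longlonglongrightarrow> 0"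
proof (rule LIMSEQ_I)
  fix e :: real assume "e > 0"
  \<comment> \<open>The interval has length 2, so a uniform error \<open>d\<close> gives a squared
    mean error of at most 2 d^2 = e/2.\<close>
  define d where "d = sqrt e / 2"
  have "d > 0" "d\<^sup>2 = e / 4" using \<open>e > 0\<close> by (auto simp: d_def power_divide)
  obtain g where g: "real_polynomial_function g" "\<And>s. s \<in> {-1..1} \<Longrightarrow> \<bar>f s - g s\<bar> < d"
    using Stone_Weierstrass_real_polynomial_function[OF _ f \<open>d > 0\<close>] by auto
  then obtain a n where an: "g = (\<lambda>s. \<Sum>i\<le>n. a i * s ^ i)"
    using real_polynomial_function_imp_sum by blast
  define p where "p = (\<Sum>i\<le>n. monom (a i) i)"
  have p: "poly p s = g s" for s unfolding p_def an by (simp add: poly_sum poly_monom)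
  have "degree p \<le> n"
    unfolding p_def by (intro degree_sum_le) (auto intro: order_trans[OF degree_monom_le])
  have contP: "continuous_on {-1..1} (legendre_P n)" for n
    unfolding legendre_P_def by (intro continuous_intros)
  have "integral {-1..1} (\<lambda>s. (f s - poly p s)\<^sup>2) \<le> integral {-1..1} (\<lambda>s::real. d\<^sup>2)"
  proof (intro integral_le integrable_continuous_real continuous_intros f)
    fix s :: real assume "s \<in> {-1..1}"
    then have "\<bar>f s - poly p s\<bar> \<le> \<bar>d\<bar>" using g(2)[of s] by (simp add: p)
    then show "(f s - poly p s)\<^sup>2 \<le> d\<^sup>2" by (simp add: abs_le_square_iff)
  qed
  also have "\<dots> < e" using \<open>d\<^sup>2 = e / 4\<close> \<open>e > 0\<close> by simp
  finally have less: "integral {-1..1} (\<lambda>s. (f s - poly p s)\<^sup>2) < e" .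
  have "norm (integral {-1..1} (\<lambda>s. (f s - (\<Sum>n\<le>N. c n * legendre_P n s))\<^sup>2) - 0) < e" if "N \<ge> n" for N
  proof -
    have "integral {-1..1} (\<lambda>s. (f s - (\<Sum>n\<le>N. c n * legendre_P n s))\<^sup>2) \<ge> 0"
      by (intro integral_nonneg integrable_continuous_real continuous_intros contP f) auto
    moreover have "integral {-1..1} (\<lambda>s. (f s - (\<Sum>n\<le>N. c n * legendre_P n s))\<^sup>2)
        \<le> integral {-1..1} (\<lambda>s. (f s - poly p s)\<^sup>2)"
      unfolding c_def using \<open>degree p \<le> n\<close> that
      by (intro legendre_partial_sum_best_approximation f) auto
    ultimately show ?thesis using less by simp
  qed
  then show "\<exists>n0. \<forall>N\<ge>n0. norm (integral {-1..1} (\<lambda>s. (f s - (\<Sum>n\<le>N. c n * legendre_P n s))\<^sup>2) - 0) < e"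
    by blast
qed

text \<open>The Legendre polynomials are real, so expansion and squared error split into those of
  the real and imaginary parts.\<close>

lemma legendre_expansion_L2:
  fixes f :: "real \<Rightarrow> complex"
  defines "c \<equiv> \<lambda>n. (2 * of_nat n + 1) / 2 * integral {-1..1} (\<lambda>s. f s * of_real (legendre_P n s))"
  assumes f: "continuous_on {-1..1} f"
  shows "(\<lambda>N. integral {-1..1} (\<lambda>s. (cmod (f s - (\<Sum>n\<le>N. c n * of_real (legendre_P n s))))\<^sup>2)) \<longlonglongrightarrow> 0"
proof -
  have contP: "continuous_on {-1..1} (legendre_P n)" for n
    unfolding legendre_P_def by (intro continuous_intros)
  have int: "(\<lambda>s. f s * of_real (legendre_P n s)) integrable_on {-1..1}" for n
    by (intro integrable_continuous_real continuous_intros f contP)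
  have half: "(2 * of_nat n + 1) / 2 = complex_of_real ((2 * real n + 1) / 2)" for n by simp
  have Re: "Re (c n) = (2 * real n + 1) / 2 * integral {-1..1} (\<lambda>s. Re (f s) * legendre_P n s)" for n
    using integral_linear[OF int[of n] bounded_linear_Re]
    unfolding c_def half by (simp add: o_def)
  have Im: "Im (c n) = (2 * real n + 1) / 2 * integral {-1..1} (\<lambda>s. Im (f s) * legendre_P n s)" for n
    using integral_linear[OF int[of n] bounded_linear_Im]
    unfolding c_def half by (simp add: o_def)
  have "integral {-1..1} (\<lambda>s. (cmod (f s - (\<Sum>n\<le>N. c n * of_real (legendre_P n s))))\<^sup>2)
      = integral {-1..1} (\<lambda>s. (Re (f s) - (\<Sum>n\<le>N. Re (c n) * legendre_P n s))\<^sup>2)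
      + integral {-1..1} (\<lambda>s. (Im (f s) - (\<Sum>n\<le>N. Im (c n) * legendre_P n s))\<^sup>2)" for N
    unfolding cmod_power2
    by (subst integral_add[symmetric])
       (auto intro!: integrable_continuous_real continuous_intros contP f)
  moreover have "(\<lambda>N. integral {-1..1} (\<lambda>s. (Re (f s) - (\<Sum>n\<le>N. Re (c n) * legendre_P n s))\<^sup>2)
      + integral {-1..1} (\<lambda>s. (Im (f s) - (\<Sum>n\<le>N. Im (c n) * legendre_P n s))\<^sup>2)) \<longlonglongrightarrow> 0 + 0"
    unfolding Re Im by (intro tendsto_add legendre_expansion_L2_real continuous_intros f)
  ultimately show ?thesis by simp
qed

lemma Cauchy_Schwarz_integral:
  fixes f g :: "real \<Rightarrow> complex"
  assumes f: "continuous_on {a..b} f" and g: "continuous_on {a..b} g"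
  shows "cmod (integral {a..b} (\<lambda>t. f t * g t))
    \<le> sqrt (integral {a..b} (\<lambda>t. (cmod (f t))\<^sup>2)) * sqrt (integral {a..b} (\<lambda>t. (cmod (g t))\<^sup>2))"
proof -
  define A where "A = integral {a..b} (\<lambda>t. (cmod (f t))\<^sup>2)"
  define B where "B = integral {a..b} (\<lambda>t. (cmod (g t))\<^sup>2)"
  define I where "I = integral {a..b} (\<lambda>t. cmod (f t) * cmod (g t))"
  \<comment> \<open>Discriminant argument: the quadratic \<open>\<integral> (|g| - s |f|)\<^sup>2\<close> in \<open>s\<close> is nonnegative.\<close>
  have pos: "0 \<le> B - 2 * s * I + s\<^sup>2 * A" for s
  proof -
    have "0 \<le> integral {a..b} (\<lambda>t. (cmod (g t) - s * cmod (f t))\<^sup>2)"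
      by (intro integral_nonneg integrable_continuous_real continuous_intros f g) auto
    also have "(\<lambda>t. (cmod (g t) - s * cmod (f t))\<^sup>2)
        = (\<lambda>t. ((cmod (g t))\<^sup>2 - 2 * s * (cmod (f t) * cmod (g t))) + s\<^sup>2 * (cmod (f t))\<^sup>2)"
      by (auto simp: power2_eq_square algebra_simps)
    also have "integral {a..b} \<dots> = integral {a..b} (\<lambda>t. (cmod (g t))\<^sup>2 - 2 * s * (cmod (f t) * cmod (g t)))
        + integral {a..b} (\<lambda>t. s\<^sup>2 * (cmod (f t))\<^sup>2)"
      by (intro integral_add integrable_continuous_real continuous_intros f g)
    also have "integral {a..b} (\<lambda>t. (cmod (g t))\<^sup>2 - 2 * s * (cmod (f t) * cmod (g t)))
        = B - integral {a..b} (\<lambda>t. 2 * s * (cmod (f t) * cmod (g t)))"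
      unfolding B_def by (intro integral_diff integrable_continuous_real continuous_intros f g)
    finally show ?thesis unfolding A_def I_def by simp
  qed
  have "A \<ge> 0" unfolding A_def
    by (intro integral_nonneg integrable_continuous_real continuous_intros f) auto
  have "I\<^sup>2 \<le> A * B"
  proof (cases "A = 0")
    case True
    \<comment> \<open>For \<open>A = 0\<close> the quadratic is affine in \<open>s\<close>; if
      \<open>I\<close> were nonzero, this \<open>s\<close> would give it the value -1.\<close>
    then show ?thesis using pos[of "(B + 1) / (2 * I)"] by (cases "I = 0") auto
  next
    case False
    then have "A > 0" using \<open>A \<ge> 0\<close> by simp
    \<comment> \<open>Here \<open>s = I / A\<close> is the minimiser of the quadratic.\<close>
    then have "0 \<le> B - I\<^sup>2 / A" using pos[of "I / A"] by (simp add: power2_eq_square)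
    then show ?thesis using \<open>A > 0\<close> by (simp add: field_simps)
  qed
  then have "I \<le> sqrt (A * B)" by (rule real_le_rsqrt)
  moreover have "cmod (integral {a..b} (\<lambda>t. f t * g t)) \<le> I"
    unfolding I_def
    by (intro integral_norm_bound_integral integrable_continuous_real continuous_intros f g)
       (simp add: norm_mult)
  ultimately show ?thesis unfolding A_def B_def by (simp add: real_sqrt_mult)
qed

section \<open>Boundary derivatives of the transmutation kernel\<close>

lemma compact_triangle:
  "compact {(\<alpha>, \<beta>). 0 \<le> \<alpha> \<and> 0 \<le> \<beta> \<and> \<alpha> + \<beta> \<le> (x::real)}" (is "compact ?T")
proof -
  have "?T = cbox (0, 0) (x, x) \<inter> {p. fst p + snd p \<le> x}"
    by (auto simp: cbox_Pair_eq)
  moreover have "closed {p :: real \<times> real. fst p + snd p \<le> x}"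
    by (intro closed_Collect_le continuous_intros)
  ultimately show ?thesis by (simp add: compact_Int_closed)
qed

text \<open>As \<open>t \<rightarrow> x\<close> the rectangle shrinks to the segment \<open>\<beta> = 0\<close>, so the double integral is
  \<open>(x - t) / 2\<close> times the line integral, up to an error controlled by uniform continuity.\<close>

lemma triangle_double_integral_derivative_right:
  fixes g :: "real \<Rightarrow> real \<Rightarrow> complex"
  defines "G \<equiv> \<lambda>x t. integral {0..(x + t) / 2} (\<lambda>\<alpha>. integral {0..(x - t) / 2} (g \<alpha>))"
  assumes "0 < x" and g: "continuous_on {(\<alpha>, \<beta>). 0 \<le> \<alpha> \<and> 0 \<le> \<beta> \<and> \<alpha> + \<beta> \<le> x} (\<lambda>(\<alpha>, \<beta>). g \<alpha> \<beta>)"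
  shows "(G x has_vector_derivative - (1 / 2) * integral {0..x} (\<lambda>\<alpha>. g \<alpha> 0)) (at x within {-x..x})"
proof -
  define T where "T = {(\<alpha>, \<beta>). 0 \<le> \<alpha> \<and> 0 \<le> \<beta> \<and> \<alpha> + \<beta> \<le> x}"
  define I where "I = integral {0..x} (\<lambda>\<alpha>. g \<alpha> 0)"
  have "compact T" unfolding T_def using compact_triangle .
  have T: "continuous_on T (\<lambda>(\<alpha>, \<beta>). g \<alpha> \<beta>)" unfolding T_def by (rule g)
  have slice: "continuous_on {0..a} (\<lambda>\<alpha>. g \<alpha> \<beta>)" if "0 \<le> \<beta>" "a + \<beta> \<le> x" for a \<beta>
  proof -
    have "(\<lambda>\<alpha>. (\<alpha>, \<beta>)) ` {0..a} \<subseteq> T" using that by (auto simp: T_def)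
    then have "continuous_on {0..a} (\<lambda>\<alpha>. case (\<alpha>, \<beta>) of (\<alpha>, \<beta>) \<Rightarrow> g \<alpha> \<beta>)"
      by (intro continuous_on_compose2[OF T] continuous_intros)
    then show ?thesis by simp
  qed
  have "\<exists>d>0. \<forall>t\<in>{-x..x}. norm (t - x) < d \<longrightarrow>
      norm (G x t - G x x - (t - x) *\<^sub>R (- (1 / 2) * I)) \<le> e * norm (t - x)" if "e > 0" for e
  proof -
    obtain M where "\<forall>y\<in>(\<lambda>(\<alpha>, \<beta>). g \<alpha> \<beta>) ` T. norm y \<le> M"
      using compact_imp_bounded[OF compact_continuous_image[OF T \<open>compact T\<close>]]
      unfolding bounded_iff by blast
    then have M: "norm ((\<lambda>(\<alpha>, \<beta>). g \<alpha> \<beta>) p) \<le> M" if "p \<in> T" for p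
      using that by blast
    have "cmod (g 0 0) \<le> M" using M[of "(0, 0)"] \<open>0 < x\<close> by (simp add: T_def)
    then have "M \<ge> 0" by (rule order_trans[OF norm_ge_zero])
    \<comment> \<open>A pointwise error \<open>e / x\<close> on the rectangle with sides w \<le> x
      and h integrates to at most h e.\<close>
    have "e / x > 0" using \<open>e > 0\<close> \<open>0 < x\<close> by simp
    then obtain d where d: "d > 0" "\<And>p p'. p \<in> T \<Longrightarrow> p' \<in> T \<Longrightarrow> dist p' p < d \<Longrightarrow>
        dist ((\<lambda>(\<alpha>, \<beta>). g \<alpha> \<beta>) p') ((\<lambda>(\<alpha>, \<beta>). g \<alpha> \<beta>) p) < e / x"
      using compact_uniformly_continuous[OF T \<open>compact T\<close>] unfolding uniformly_continuous_on_def by meson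
    have near: "cmod (g \<alpha> \<beta> - g \<alpha> 0) \<le> e / x" if "0 \<le> \<alpha>" "0 \<le> \<beta>" "\<alpha> + \<beta> \<le> x" "\<beta> < d" for \<alpha> \<beta>
      using d(2)[of "(\<alpha>, 0)" "(\<alpha>, \<beta>)"] that by (force simp: T_def dist_norm norm_Pair)
    have "norm (G x t - G x x - (t - x) *\<^sub>R (- (1 / 2) * I)) \<le> e * norm (t - x)"
      \<comment> \<open>The bound \<open>e / (M + 1)\<close> forces \<open>h * M \<le> e\<close>,
        which controls the missing piece of the segment; the added 1 keeps the denominator
        positive.\<close>
      if t: "t \<in> {-x..x}" "norm (t - x) < min d (e / (M + 1))" for t
    proof -
      define h where "h = (x - t) / 2"
      define w where "w = (x + t) / 2"
      have "norm (t - x) = 2 * h" "h \<ge> 0" "w \<ge> 0" "w + h = x"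
        using t unfolding h_def w_def by (auto simp: field_simps)
      moreover from this t have "h < d" "h \<le> e / (M + 1)" by linarith+
      ultimately have hw: "h \<ge> 0" "w \<ge> 0" "w + h = x" "h < d" "h \<le> e / (M + 1)" by blast+
      have "h * M \<le> h * (M + 1)" using hw by (intro mult_left_mono) auto
      also have "\<dots> \<le> e" using hw \<open>M \<ge> 0\<close> by (simp add: field_simps)
      finally have hM: "h * M \<le> e" .
      have box: "continuous_on ({0..w} \<times> cbox 0 h) (\<lambda>(\<alpha>, \<beta>). g \<alpha> \<beta>)"
        by (rule continuous_on_subset[OF T]) (use hw in \<open>auto simp: T_def\<close>)
      have inner: "continuous_on {0..h} (g \<alpha>)" if "\<alpha> \<in> {0..w}" for \<alpha>
      proof -
        have "(\<lambda>\<beta>. (\<alpha>, \<beta>)) ` {0..h} \<subseteq> {0..w} \<times> cbox 0 h" using that by auto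
        then have "continuous_on {0..h} (\<lambda>\<beta>. case (\<alpha>, \<beta>) of (\<alpha>, \<beta>) \<Rightarrow> g \<alpha> \<beta>)"
          by (intro continuous_on_compose2[OF box] continuous_intros)
        then show ?thesis by simp
      qed
      have outer: "continuous_on {0..w} (\<lambda>\<alpha>. integral {0..h} (g \<alpha>))"
        using integral_continuous_on_param[OF box] by simp
      have 1: "cmod (integral {0..w} (\<lambda>\<alpha>. integral {0..h} (g \<alpha>) - of_real h * g \<alpha> 0)) \<le> h * e / x * (w - 0)"
      proof (rule integral_bound)
        fix \<alpha> assume \<alpha>: "\<alpha> \<in> {0..w}"
        have "integral {0..h} (g \<alpha>) - of_real h * g \<alpha> 0 = integral {0..h} (\<lambda>\<beta>. g \<alpha> \<beta> - g \<alpha> 0)"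
          using hw by (subst integral_diff)
            (auto intro!: integrable_continuous_real inner[OF \<alpha>] simp: scaleR_conv_of_real)
        also have "cmod \<dots> \<le> e / x * (h - 0)"
          using hw \<alpha> by (intro integral_bound continuous_intros inner near) auto
        finally show "cmod (integral {0..h} (g \<alpha>) - of_real h * g \<alpha> 0) \<le> h * e / x" by (simp add: mult.commute)
      qed (use hw in \<open>auto intro!: continuous_intros outer slice\<close>)
      have "continuous_on {0..x} (\<lambda>\<alpha>. g \<alpha> 0)" by (intro slice) auto
      then have "integral {0..w} (\<lambda>\<alpha>. g \<alpha> 0) + integral {w..x} (\<lambda>\<alpha>. g \<alpha> 0) = I"
        unfolding I_def using hw by (intro Henstock_Kurzweil_Integration.integral_combine integrable_continuous_real) auto
      then have "of_real h * I = integral {0..w} (\<lambda>\<alpha>. of_real h * g \<alpha> 0) + of_real h * integral {w..x} (\<lambda>\<alpha>. g \<alpha> 0)"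
        by (simp flip: distrib_left)
      moreover have "integral {0..w} (\<lambda>\<alpha>. integral {0..h} (g \<alpha>) - of_real h * g \<alpha> 0)
          = integral {0..w} (\<lambda>\<alpha>. integral {0..h} (g \<alpha>)) - integral {0..w} (\<lambda>\<alpha>. of_real h * g \<alpha> 0)"
        using hw by (intro integral_diff integrable_continuous_real continuous_intros outer slice) auto
      moreover have "G x t = integral {0..w} (\<lambda>\<alpha>. integral {0..h} (g \<alpha>))"
        unfolding G_def h_def w_def ..
      \<comment> \<open>Two errors arise: replacing g(\<alpha>, \<beta>) by g(\<alpha>, 0) on the
        rectangle, and stopping the line integral at \<open>w\<close> instead of \<open>x\<close>.
        Each is at most h e, and 2 h is the distance from \<open>t\<close> to
        \<open>x\<close>.\<close>
      ultimately have split: "G x t - of_real h * I = integral {0..w} (\<lambda>\<alpha>. integral {0..h} (g \<alpha>) - of_real h * g \<alpha> 0)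
          - of_real h * integral {w..x} (\<lambda>\<alpha>. g \<alpha> 0)"
        by simp
      have 2: "cmod (integral {w..x} (\<lambda>\<alpha>. g \<alpha> 0)) \<le> M * (x - w)"
      proof (rule integral_bound)
        show "continuous_on {w..x} (\<lambda>\<alpha>. g \<alpha> 0)"
          by (rule continuous_on_subset[OF slice[of 0 x]]) (use hw in auto)
        show "cmod (g \<alpha> 0) \<le> M" if "\<alpha> \<in> {w..x}" for \<alpha>
          using M[of "(\<alpha>, 0)"] that hw by (auto simp: T_def)
      qed (use hw in auto)
      have "h * e / x * w \<le> h * e / x * x"
        using hw \<open>e > 0\<close> \<open>0 < x\<close> by (intro mult_left_mono) auto
      then have 3: "h * e / x * (w - 0) \<le> h * e" using \<open>0 < x\<close> by simp
      have "cmod (of_real h * integral {w..x} (\<lambda>\<alpha>. g \<alpha> 0)) \<le> h * (M * h)"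
      proof -
        have "x - w = h" using hw by simp
        from mult_left_mono[OF 2[unfolded this] hw(1)] show ?thesis
          using hw by (simp add: norm_mult)
      qed
      also have "\<dots> \<le> h * e" using mult_left_mono[OF hM hw(1)] by (simp add: mult_ac)
      finally have "cmod (G x t - of_real h * I) \<le> h * e + h * e"
        unfolding split using 1 3 by (intro order_trans[OF norm_triangle_ineq4] add_mono) auto
      moreover have "G x x = 0" by (simp add: G_def)
      moreover have "(t - x) *\<^sub>R (- (1 / 2) * I) = of_real h * I"
      proof -
        have "t - x = - 2 * h" by (simp add: h_def)
        then show ?thesis by (simp only: scaleR_conv_of_real) simp
      qed
      moreover have "norm (t - x) = 2 * h" using t by (simp add: h_def)
      ultimately show ?thesis by (simp add: mult_ac)
    qed
    moreover have "min d (e / (M + 1)) > 0" using d(1) \<open>e > 0\<close> \<open>M \<ge> 0\<close> by simp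
    ultimately show ?thesis by blast
  qed
  then show ?thesis
    unfolding has_vector_derivative_def has_derivative_within_alt I_def
    using bounded_linear_scaleR_left by blast
qed

text \<open>As t tends to -x the rectangle shrinks to the segment \<alpha> = 0, on which
  \<open>g\<close> vanishes. By uniform continuity \<open>g\<close> is small on the whole rectangle,
  so the double integral is of smaller order than its width.\<close>

lemma triangle_double_integral_derivative_left:
  fixes g :: "real \<Rightarrow> real \<Rightarrow> complex"
  defines "G \<equiv> \<lambda>x t. integral {0..(x + t) / 2} (\<lambda>\<alpha>. integral {0..(x - t) / 2} (g \<alpha>))"
  assumes "0 < x" and g: "continuous_on {(\<alpha>, \<beta>). 0 \<le> \<alpha> \<and> 0 \<le> \<beta> \<and> \<alpha> + \<beta> \<le> x} (\<lambda>(\<alpha>, \<beta>). g \<alpha> \<beta>)"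
    and zero: "\<And>\<beta>. \<beta> \<in> {0..x} \<Longrightarrow> g 0 \<beta> = 0"
  shows "(G x has_vector_derivative 0) (at (-x) within {-x..x})"
proof -
  define T where "T = {(\<alpha>, \<beta>). 0 \<le> \<alpha> \<and> 0 \<le> \<beta> \<and> \<alpha> + \<beta> \<le> x}"
  have "compact T" unfolding T_def using compact_triangle .
  have T: "continuous_on T (\<lambda>(\<alpha>, \<beta>). g \<alpha> \<beta>)" unfolding T_def by (rule g)
  have "\<exists>d>0. \<forall>t\<in>{-x..x}. norm (t - -x) < d \<longrightarrow> norm (G x t - G x (-x)) \<le> e * norm (t - -x)"
    if "e > 0" for e
  proof -
    have "e / x > 0" using \<open>e > 0\<close> \<open>0 < x\<close> by simp
    then obtain d where d: "d > 0" "\<And>p p'. p \<in> T \<Longrightarrow> p' \<in> T \<Longrightarrow> dist p' p < d \<Longrightarrow>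
        dist ((\<lambda>(\<alpha>, \<beta>). g \<alpha> \<beta>) p') ((\<lambda>(\<alpha>, \<beta>). g \<alpha> \<beta>) p) < e / x"
      using compact_uniformly_continuous[OF T \<open>compact T\<close>] unfolding uniformly_continuous_on_def by meson
    have near: "cmod (g \<alpha> \<beta>) \<le> e / x" if "0 \<le> \<alpha>" "0 \<le> \<beta>" "\<alpha> + \<beta> \<le> x" "\<alpha> < d" for \<alpha> \<beta>
      using d(2)[of "(0, \<beta>)" "(\<alpha>, \<beta>)"] zero[of \<beta>] that by (force simp: T_def dist_norm norm_Pair)
    have "norm (G x t - G x (-x)) \<le> e * norm (t - -x)"
      if t: "t \<in> {-x..x}" "norm (t - -x) < d" for t
    proof -
      define h where "h = (x - t) / 2"
      define w where "w = (x + t) / 2"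
      have hw: "h \<ge> 0" "w \<ge> 0" "w + h = x" "w < d"
        using t unfolding h_def w_def by (auto simp: field_simps)
      have box: "continuous_on ({0..w} \<times> cbox 0 h) (\<lambda>(\<alpha>, \<beta>). g \<alpha> \<beta>)"
        by (rule continuous_on_subset[OF T]) (use hw in \<open>auto simp: T_def\<close>)
      have inner: "continuous_on {0..h} (g \<alpha>)" if "\<alpha> \<in> {0..w}" for \<alpha>
      proof -
        have "(\<lambda>\<beta>. (\<alpha>, \<beta>)) ` {0..h} \<subseteq> {0..w} \<times> cbox 0 h" using that by auto
        then have "continuous_on {0..h} (\<lambda>\<beta>. case (\<alpha>, \<beta>) of (\<alpha>, \<beta>) \<Rightarrow> g \<alpha> \<beta>)"
          by (intro continuous_on_compose2[OF box] continuous_intros)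
        then show ?thesis by simp
      qed
      have "cmod (integral {0..w} (\<lambda>\<alpha>. integral {0..h} (g \<alpha>))) \<le> e * (w - 0)"
      proof (rule integral_bound)
        show "continuous_on {0..w} (\<lambda>\<alpha>. integral {0..h} (g \<alpha>))"
          using integral_continuous_on_param[OF box] by simp
        fix \<alpha> assume \<alpha>: "\<alpha> \<in> {0..w}"
        have "cmod (integral {0..h} (g \<alpha>)) \<le> e / x * (h - 0)"
          using hw \<alpha> by (intro integral_bound inner near) auto
        also have "\<dots> \<le> e / x * x" using hw \<open>e > 0\<close> \<open>0 < x\<close> by (intro mult_left_mono) auto
        finally show "cmod (integral {0..h} (g \<alpha>)) \<le> e" using \<open>0 < x\<close> by simp
      qed (use hw in auto)
      moreover have "e * w \<le> e * norm (t - -x)"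
        using t \<open>e > 0\<close> by (intro mult_left_mono) (auto simp: w_def)
      ultimately show ?thesis by (simp add: G_def flip: w_def h_def)
    qed
    then show ?thesis using d(1) by blast
  qed
  then show ?thesis
    unfolding has_vector_derivative_def has_derivative_within_alt by simp
qed

section \<open>The second-argument derivative of the kernel at both ends of a slice\<close>

lemma Qint_has_vector_derivative:
  assumes "continuous_on {0..b} q" "x \<in> {0..b}"
  shows "(Qint q has_vector_derivative q x) (at x within {0..b})"
  using integral_has_vector_derivative[OF assms] unfolding Qint_def[abs_def] .

text \<open>An antiderivative is Q^2 / 4. The integrand is q(s) K(s, s), so this evaluates the line
  integral along the diagonal.\<close>

lemma has_integral_mult_Qint:
  assumes q: "continuous_on {0..b} q" and x: "x \<in> {0..b}"
  shows "((\<lambda>s. q s * (Qint q s / 2)) has_integral (Qint q x)\<^sup>2 / 4) {0..x}"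
proof -
  have "((\<lambda>s. q s * (Qint q s / 2)) has_integral (Qint q x)\<^sup>2 / 4 - (Qint q 0)\<^sup>2 / 4) {0..x}"
  proof (rule fundamental_theorem_of_calculus)
    fix s assume s: "s \<in> {0..x}"
    have "(Qint q has_vector_derivative q s) (at s within {0..x})"
      by (rule has_vector_derivative_within_subset[OF Qint_has_vector_derivative[OF q]]) (use s x in auto)
    then have "((\<lambda>s. Qint q s * Qint q s / 4) has_vector_derivative (Qint q s * q s + q s * Qint q s) / 4) (at s within {0..x})"
      by (intro has_vector_derivative_divide has_vector_derivative_mult)
    then show "((\<lambda>s. (Qint q s)\<^sup>2 / 4) has_vector_derivative q s * (Qint q s / 2)) (at s within {0..x})"
      by (simp add: power2_eq_square mult.commute)
  qed (use x in auto)
  then show ?thesis by (simp add: Qint_def)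
qed

context
  fixes b :: real and q :: "real \<Rightarrow> complex" and K :: "real \<Rightarrow> real \<Rightarrow> complex" and x :: real
  assumes q: "continuous_on {0..b} q" and K: "continuous_on (kernel_domain b) (\<lambda>(x, t). K x t)"
    and diag: "\<And>y. y \<in> {0..b} \<Longrightarrow> K y y = Qint q y / 2" and antidiag: "\<And>y. y \<in> {0..b} \<Longrightarrow> K y (-y) = 0"
    and eq: "\<And>x t. (x, t) \<in> kernel_domain b \<Longrightarrow> K x t = Qint q ((x + t) / 2) / 2
          + integral {0..(x + t) / 2} (\<lambda>\<alpha>. integral {0..(x - t) / 2}
              (\<lambda>\<beta>. q (\<alpha> + \<beta>) * K (\<alpha> + \<beta>) (\<alpha> - \<beta>)))"
    and x: "0 < x" "x \<le> b"
begin

text \<open>The map from (\<alpha>, \<beta>) to (\<alpha> + \<beta>, \<alpha> - \<beta>) sends this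
  triangle into \<open>kernel_domain b\<close>.\<close>

lemma kernel_integrand_continuous:
  "continuous_on {(\<alpha>, \<beta>). 0 \<le> \<alpha> \<and> 0 \<le> \<beta> \<and> \<alpha> + \<beta> \<le> x}
    (\<lambda>(\<alpha>, \<beta>). q (\<alpha> + \<beta>) * K (\<alpha> + \<beta>) (\<alpha> - \<beta>))"
proof -
  let ?T = "{(\<alpha>, \<beta>). 0 \<le> \<alpha> \<and> 0 \<le> \<beta> \<and> \<alpha> + \<beta> \<le> x}"
  have "continuous_on ?T (\<lambda>p. q (fst p + snd p))"
    by (rule continuous_on_compose2[OF q]) (use x in \<open>auto intro!: continuous_intros\<close>)
  moreover have "continuous_on ?T (\<lambda>p. (\<lambda>(x, t). K x t) (fst p + snd p, fst p - snd p))"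
    by (rule continuous_on_compose2[OF K])
       (use x in \<open>auto intro!: continuous_intros simp: kernel_domain_def\<close>)
  ultimately have "continuous_on ?T (\<lambda>p. q (fst p + snd p) * K (fst p + snd p) (fst p - snd p))"
    using continuous_on_mult by fastforce
  then show ?thesis by (simp add: case_prod_unfold)
qed

text \<open>Differentiate the integral equation in its second argument: the Q term contributes q/4,
  one factor 1/2 from the equation and one from the chain rule. The derivative \<open>D\<close> of
  the double integral stays abstract because the two ends of the slice supply different
  values.\<close>

lemma kernel_deriv_from_double_integral:
  assumes t: "t \<in> {-x..x}"
    and D: "((\<lambda>t. integral {0..(x + t) / 2} (\<lambda>\<alpha>. integral {0..(x - t) / 2}
              (\<lambda>\<beta>. q (\<alpha> + \<beta>) * K (\<alpha> + \<beta>) (\<alpha> - \<beta>)))) has_vector_derivative D) (at t within {-x..x})"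
  shows "(K x has_vector_derivative q ((x + t) / 2) / 4 + D) (at t within {-x..x})"
proof -
  have "((\<lambda>t. (x + t) / 2) has_vector_derivative 1 / 2) (at t within {-x..x})"
    by (auto intro!: derivative_eq_intros)
  moreover have "(Qint q has_vector_derivative q ((x + t) / 2)) (at ((x + t) / 2) within (\<lambda>t. (x + t) / 2) ` {-x..x})"
    by (rule has_vector_derivative_within_subset[OF Qint_has_vector_derivative[OF q]]) (use t x in auto)
  ultimately have "(Qint q \<circ> (\<lambda>t. (x + t) / 2) has_vector_derivative (1 / 2) *\<^sub>R q ((x + t) / 2)) (at t within {-x..x})"
    by (rule vector_diff_chain_within)
  then have "((\<lambda>t. Qint q ((x + t) / 2)) has_vector_derivative (1 / 2) *\<^sub>R q ((x + t) / 2)) (at t within {-x..x})"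
    by (simp add: o_def)
  from has_vector_derivative_transform[OF t _ has_vector_derivative_add[OF has_vector_derivative_divide[OF this, of 2] D]]
  have "(K x has_vector_derivative (1 / 2) *\<^sub>R q ((x + t) / 2) / 2 + D) (at t within {-x..x})"
  proof this
    fix s assume "s \<in> {-x..x}"
    then have "(x, s) \<in> kernel_domain b" using x by (auto simp: kernel_domain_def)
    then show "K x s = Qint q ((x + s) / 2) / 2 + integral {0..(x + s) / 2} (\<lambda>\<alpha>. integral {0..(x - s) / 2}
              (\<lambda>\<beta>. q (\<alpha> + \<beta>) * K (\<alpha> + \<beta>) (\<alpha> - \<beta>)))" by (rule eq)
  qed
  moreover have "(1 / 2) *\<^sub>R q ((x + t) / 2) / 2 = q ((x + t) / 2) / 4"
    by (simp add: scaleR_conv_of_real)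
  ultimately show ?thesis by (simp only:)
qed

text \<open>The rectangle degenerates to \<beta> = 0, where the kernel is Q/2. The line integral is
  Q(x)^2 / 4, and the factor -1/2 from the shrinking side gives -Q(x)^2 / 8.\<close>

lemma kernel_derivative_diagonal:
  "(K x has_vector_derivative q x / 4 - (Qint q x)\<^sup>2 / 8) (at x within {-x..x})"
proof -
  have "integral {0..x} (\<lambda>\<alpha>. q (\<alpha> + 0) * K (\<alpha> + 0) (\<alpha> - 0)) = integral {0..x} (\<lambda>s. q s * (Qint q s / 2))"
    using x by (intro integral_cong) (simp add: diag)
  also have "\<dots> = (Qint q x)\<^sup>2 / 4"
    using x by (intro integral_unique has_integral_mult_Qint[OF q]) auto
  finally have I: "integral {0..x} (\<lambda>\<alpha>. q (\<alpha> + 0) * K (\<alpha> + 0) (\<alpha> - 0)) = (Qint q x)\<^sup>2 / 4" .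
  note D = triangle_double_integral_derivative_right[OF x(1) kernel_integrand_continuous, unfolded I]
  have "x \<in> {-x..x}" using x by simp
  from kernel_deriv_from_double_integral[OF this D] show ?thesis by simp
qed

text \<open>The rectangle degenerates to \<alpha> = 0, where the integrand contains K(\<beta>,
  -\<beta>) = 0; only the q/4 term, taken at 0, remains.\<close>

lemma kernel_derivative_antidiagonal:
  "(K x has_vector_derivative q 0 / 4) (at (-x) within {-x..x})"
proof -
  have "q (0 + \<beta>) * K (0 + \<beta>) (0 - \<beta>) = 0" if "\<beta> \<in> {0..x}" for \<beta>
    using that x by (simp add: antidiag)
  note D = triangle_double_integral_derivative_left[OF x(1) kernel_integrand_continuous this]
  have "-x \<in> {-x..x}" using x by simp
  from kernel_deriv_from_double_integral[OF this D] show ?thesis by simp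
qed

end

section \<open>The Neumann series of Bessel functions\<close>

text \<open>For positive \<open>x\<close> the slice is a proper interval, so one-sided derivatives
  are unique and the derivatives chosen in \<open>K22\<close> agree with any given
  witnesses.\<close>

lemma K22_eqI:
  assumes "0 < x" and t: "t \<in> {-x..x}"
    and K2: "\<And>t. t \<in> {-x..x} \<Longrightarrow> (K x has_vector_derivative K2 t) (at t within {-x..x})"
    and K22: "(K2 has_vector_derivative d) (at t within {-x..x})"
  shows "K22 K x t = d"
proof -
  have "partial2 K x s = K2 s" if "s \<in> {-x..x}" for s
    unfolding partial2_def using \<open>0 < x\<close> that K2[OF that]
    by (intro vector_derivative_within_closed_interval) auto
  then have "(partial2 K x has_vector_derivative d) (at t within {-x..x})"
    using has_vector_derivative_transform[OF t _ K22] by blast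
  then show ?thesis
    unfolding K22_def partial2_def[of "partial2 K"] using \<open>0 < x\<close> t
    by (intro vector_derivative_within_closed_interval) auto
qed

text \<open>Both integrations by parts are packed into one antiderivative,
  \<open>(k t / (\<i> * \<omega>) + k1 t / \<omega>\<^sup>2) * E t\<close>: on differentiation the
  two terms containing \<open>k1\<close> cancel.\<close>

lemma integral_exp_by_parts_twice:
  fixes k k1 k2 :: "real \<Rightarrow> complex"
  assumes "a \<le> b" "\<omega> \<noteq> 0"
    and k: "\<And>t. t \<in> {a..b} \<Longrightarrow> (k has_vector_derivative k1 t) (at t within {a..b})"
    and k1: "\<And>t. t \<in> {a..b} \<Longrightarrow> (k1 has_vector_derivative k2 t) (at t within {a..b})"
    and k2: "continuous_on {a..b} k2"
  shows "integral {a..b} (\<lambda>t. k t * exp (\<i> * \<omega> * of_real t))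
    = (k b / (\<i> * \<omega>) + k1 b / \<omega>\<^sup>2) * exp (\<i> * \<omega> * of_real b)
      - (k a / (\<i> * \<omega>) + k1 a / \<omega>\<^sup>2) * exp (\<i> * \<omega> * of_real a)
      - 1 / \<omega>\<^sup>2 * integral {a..b} (\<lambda>t. k2 t * exp (\<i> * \<omega> * of_real t))"
proof -
  define E where "E = (\<lambda>t. exp (\<i> * \<omega> * of_real t))"
  have E: "(E has_vector_derivative \<i> * \<omega> * E t) (at t within {a..b})" for t
    unfolding E_def by (auto intro!: derivative_eq_intros has_vector_derivative_real_field)
  have contE: "continuous_on {a..b} E" unfolding E_def by (intro continuous_intros)
  have contk: "continuous_on {a..b} k"
    using k has_vector_derivative_continuous continuous_on_eq_continuous_within by blast
  have "((\<lambda>t. k t * E t + k2 t * E t / \<omega>\<^sup>2) has_integral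
      (k b / (\<i> * \<omega>) + k1 b / \<omega>\<^sup>2) * E b - (k a / (\<i> * \<omega>) + k1 a / \<omega>\<^sup>2) * E a) {a..b}"
  proof (rule fundamental_theorem_of_calculus[OF \<open>a \<le> b\<close>])
    fix t assume t: "t \<in> {a..b}"
    have "((\<lambda>t. (k t / (\<i> * \<omega>) + k1 t / \<omega>\<^sup>2) * E t) has_vector_derivative
        (k t / (\<i> * \<omega>) + k1 t / \<omega>\<^sup>2) * (\<i> * \<omega> * E t) + (k1 t / (\<i> * \<omega>) + k2 t / \<omega>\<^sup>2) * E t) (at t within {a..b})"
      by (intro has_vector_derivative_mult has_vector_derivative_add has_vector_derivative_divide k k1 E t)
    moreover have "(k t / (\<i> * \<omega>) + k1 t / \<omega>\<^sup>2) * (\<i> * \<omega> * E t) + (k1 t / (\<i> * \<omega>) + k2 t / \<omega>\<^sup>2) * E t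
        = k t * E t + k2 t * E t / \<omega>\<^sup>2"
      using \<open>\<omega> \<noteq> 0\<close> by (simp add: field_simps power2_eq_square)
    ultimately show "((\<lambda>t. (k t / (\<i> * \<omega>) + k1 t / \<omega>\<^sup>2) * E t) has_vector_derivative
        k t * E t + k2 t * E t / \<omega>\<^sup>2) (at t within {a..b})" by simp
  qed
  moreover have "((\<lambda>t. k t * E t + k2 t * E t / \<omega>\<^sup>2) has_integral
      integral {a..b} (\<lambda>t. k t * E t) + integral {a..b} (\<lambda>t. k2 t * E t) / \<omega>\<^sup>2) {a..b}"
    by (intro has_integral_add has_integral_divide integrable_integral integrable_continuous_real
        continuous_intros contE contk k2)
  ultimately have "(k b / (\<i> * \<omega>) + k1 b / \<omega>\<^sup>2) * E b - (k a / (\<i> * \<omega>) + k1 a / \<omega>\<^sup>2) * E a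
      = integral {a..b} (\<lambda>t. k t * E t) + integral {a..b} (\<lambda>t. k2 t * E t) / \<omega>\<^sup>2"
    by (rule has_integral_unique)
  then show ?thesis unfolding E_def by (simp add: algebra_simps)
qed

section \<open>Rescaling to [-1, 1] and the mean square of the exponential\<close>

lemma has_integral_rescale:
  fixes h :: "real \<Rightarrow> 'a::real_normed_vector"
  assumes "0 < x" "((\<lambda>s. h (x * s)) has_integral I) {-1..1}"
  shows "(h has_integral x *\<^sub>R I) {-x..x}"
proof -
  have "(\<lambda>t. t / x) ` {-x..x} = {-1..1}"
    using \<open>0 < x\<close> by (auto simp: image_iff field_simps intro!: bexI[of _ "x * _"])
  then show ?thesis
    using has_integral_stretch_real_iff[of x h I "-x" x] assms by simp
qed

text \<open>The squared modulus is exp(-2 t Im \<omega>), which depends only on the imaginary part;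
  this is the origin of the hyperbolic sine in the error bound.\<close>

lemma has_integral_norm_exp_square:
  assumes "0 < x"
  shows "((\<lambda>t. (cmod (exp (\<i> * \<omega> * of_real t)))\<^sup>2) has_integral sinh_quotient (Im \<omega>) x) {-x..x}"
proof -
  define y where "y = Im \<omega>"
  have eq: "(cmod (exp (\<i> * \<omega> * of_real t)))\<^sup>2 = exp (- 2 * y * t)" for t
    by (simp add: y_def norm_exp_eq_Re power2_eq_square flip: exp_add)
  show ?thesis
  proof (cases "y = 0")
    case True
    then show ?thesis
      unfolding eq using has_integral_const_real[of "1::real" "-x" x] \<open>0 < x\<close>
      by (simp add: sinh_quotient_def flip: y_def)
  next
    case False
    have "((\<lambda>t. exp (- 2 * y * t)) has_integral exp (- 2 * y * x) / (- 2 * y) - exp (- 2 * y * - x) / (- 2 * y)) {-x..x}"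
    proof (rule fundamental_theorem_of_calculus)
      fix t
      have "((\<lambda>t. exp (- 2 * y * t) / (- 2 * y)) has_real_derivative exp (- 2 * y * t)) (at t within {-x..x})"
        using False by (auto intro!: derivative_eq_intros)
      then show "((\<lambda>t. exp (- 2 * y * t) / (- 2 * y)) has_vector_derivative exp (- 2 * y * t)) (at t within {-x..x})"
        by (simp add: has_real_derivative_iff_has_vector_derivative)
    qed (use assms in simp)
    moreover have "exp (- 2 * y * x) / (- 2 * y) - exp (- 2 * y * - x) / (- 2 * y) = sinh_quotient y x"
      using False by (simp add: sinh_quotient_def sinh_field_def field_simps)
    ultimately show ?thesis unfolding eq by (simp add: y_def)
  qed
qed

text \<open>Comparing integrands instead of estimating the hyperbolic sine treats real and non-real
  \<omega> together. The bound depends on \<omega> only through \<open>r\<close>, as uniform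
  convergence requires.\<close>

lemma sinh_quotient_le:
  assumes "0 < x" "cmod \<omega> \<le> r"
  shows "sinh_quotient (Im \<omega>) x \<le> 2 * x * exp (2 * r * x)"
proof (rule has_integral_le[OF has_integral_norm_exp_square[OF assms(1)]])
  show "((\<lambda>t. exp (2 * r * x)) has_integral 2 * x * exp (2 * r * x)) {-x..x}"
    using has_integral_const_real[of "exp (2 * r * x)" "-x" x] assms by simp
  fix t assume t: "t \<in> {-x..x}"
  have "- (Im \<omega> * t) \<le> \<bar>Im \<omega>\<bar> * \<bar>t\<bar>" by (metis abs_ge_minus_self abs_mult)
  also have "\<dots> \<le> r * x"
    using t assms abs_Im_le_cmod[of \<omega>] by (intro mult_mono) auto
  finally show "(cmod (exp (\<i> * \<omega> * of_real t)))\<^sup>2 \<le> exp (2 * r * x)"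
    by (simp add: norm_exp_eq_Re power2_eq_square mult.commute flip: exp_add)
qed

text \<open>Substituting t = x s in the Fourier transform of P_n produces a factor \<open>x\<close>,
  which cancels the 1/x in the Fourier-Legendre expansion; the 2 is that of
  \<open>legendre_P_fourier\<close>.\<close>

lemma nsbf_partial_sum_eq_integral:
  assumes "0 < x"
  shows "2 * (\<Sum>n\<le>N. nsbf_term K \<omega> x n)
    = integral {-x..x} (\<lambda>t. K22_partial K N x t * exp (\<i> * \<omega> * of_real t))"
proof -
  have P: "((\<lambda>t. of_real (legendre_P n (t / x)) * exp (\<i> * \<omega> * of_real t)) has_integral
      x *\<^sub>R (2 * \<i> ^ n * spherical_bessel_j n (\<omega> * of_real x))) {-x..x}" for n
    using legendre_P_fourier[of n "\<omega> * of_real x"] assms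
    by (intro has_integral_rescale) (simp_all add: mult_ac)
  have "((\<lambda>t. \<Sum>n\<le>N. legendre_coeff K n x / of_real x * (of_real (legendre_P n (t / x)) * exp (\<i> * \<omega> * of_real t)))
      has_integral (\<Sum>n\<le>N. legendre_coeff K n x / of_real x * (x *\<^sub>R (2 * \<i> ^ n * spherical_bessel_j n (\<omega> * of_real x))))) {-x..x}"
    by (intro has_integral_sum has_integral_mult_right P) auto
  moreover have "(\<Sum>n\<le>N. legendre_coeff K n x / of_real x * (x *\<^sub>R (2 * \<i> ^ n * spherical_bessel_j n (\<omega> * of_real x))))
      = 2 * (\<Sum>n\<le>N. nsbf_term K \<omega> x n)"
    unfolding sum_distrib_left nsbf_term_def using assms
    by (intro sum.cong) (auto simp: scaleR_conv_of_real)
  ultimately show ?thesis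
    unfolding K22_partial_def sum_distrib_right by (simp add: integral_unique mult.assoc)
qed

text \<open>After rescaling, \<open>legendre_coeff K n x / x\<close> is the Legendre coefficient on
  [-1, 1] of the function \<open>f\<close>, and the squared error becomes
  \<open>x * d N\<close>.\<close>

lemma eps_tendsto_0:
  assumes "0 < x" and cont: "continuous_on {-x..x} (K22 K x)"
  shows "(\<lambda>N. eps K N x) \<longlonglongrightarrow> 0"
proof -
  define f where "f = (\<lambda>s. K22 K x (x * s))"
  have f: "continuous_on {-1..1} f"
  proof -
    have "x * s \<in> {-x..x}" if "s \<in> {-1..1}" for s
      using that \<open>0 < x\<close> mult_left_mono[of "-1" s x] mult_left_mono[of s 1 x] by auto
    then show ?thesis
      unfolding f_def by (intro continuous_on_compose2[OF cont] continuous_intros) auto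
  qed
  have rescale: "integral {-x..x} h = x *\<^sub>R integral {-1..1} (\<lambda>s. h (x * s))"
    if "continuous_on {-1..1} (\<lambda>s. h (x * s))" for h :: "real \<Rightarrow> 'a::banach"
    using has_integral_rescale[OF \<open>0 < x\<close> integrable_integral[OF integrable_continuous_real[OF that]]]
    by (rule integral_unique)
  define c where "c = (\<lambda>n. (2 * of_nat n + 1) / 2 * integral {-1..1} (\<lambda>s. f s * of_real (legendre_P n s)))"
  have contP: "continuous_on {-1..1} (legendre_P n)" for n
    unfolding legendre_P_def by (intro continuous_intros)
  have coeff: "legendre_coeff K n x / of_real x = c n" for n
  proof -
    have "integral {-x..x} (\<lambda>t. K22 K x t * of_real (legendre_P n (t / x)))
        = x *\<^sub>R integral {-1..1} (\<lambda>s. K22 K x (x * s) * of_real (legendre_P n (x * s / x)))"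
      using \<open>0 < x\<close> f unfolding f_def by (intro rescale) (auto intro!: continuous_intros contP)
    then show ?thesis
      using \<open>0 < x\<close> unfolding legendre_coeff_def c_def f_def by (simp add: scaleR_conv_of_real)
  qed
  define d where "d = (\<lambda>N. integral {-1..1} (\<lambda>s. (cmod (f s - (\<Sum>n\<le>N. c n * of_real (legendre_P n s))))\<^sup>2))"
  have "eps K N x = sqrt (x * d N)" for N
  proof -
    have partial: "K22_partial K N x (x * s) = (\<Sum>n\<le>N. c n * of_real (legendre_P n s))" for s
      unfolding K22_partial_def coeff using \<open>0 < x\<close> by simp
    have "integral {-x..x} (\<lambda>t. (cmod (K22 K x t - K22_partial K N x t))\<^sup>2)
        = x *\<^sub>R integral {-1..1} (\<lambda>s. (cmod (K22 K x (x * s) - K22_partial K N x (x * s)))\<^sup>2)"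
      using f unfolding f_def by (intro rescale) (auto simp: partial intro!: continuous_intros contP)
    then show ?thesis unfolding eps_def d_def f_def partial by simp
  qed
  moreover have "d \<longlonglongrightarrow> 0"
    unfolding d_def c_def by (rule legendre_expansion_L2[OF f])
  then have "(\<lambda>N. sqrt (x * d N)) \<longlonglongrightarrow> sqrt (x * 0)"
    by (intro tendsto_intros)
  ultimately show ?thesis by simp
qed

text \<open>The difference is the Fourier transform of the truncation error of the Fourier-Legendre
  expansion; Cauchy-Schwarz separates it from the exponential.\<close>

lemma nsbf_partial_sum_error:
  assumes "0 < x" and cont: "continuous_on {-x..x} (K22 K x)"
  shows "cmod (integral {-x..x} (\<lambda>t. K22 K x t * exp (\<i> * \<omega> * of_real t)) - 2 * (\<Sum>n\<le>N. nsbf_term K \<omega> x n))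
    \<le> eps K N x * sqrt (sinh_quotient (Im \<omega>) x)"
proof -
  have contN: "continuous_on {-x..x} (K22_partial K N x)"
    unfolding K22_partial_def legendre_P_def by (intro continuous_intros) (use assms in auto)
  have contE: "continuous_on {-x..x} (\<lambda>t. exp (\<i> * \<omega> * of_real t))" by (intro continuous_intros)
  have "integral {-x..x} (\<lambda>t. K22 K x t * exp (\<i> * \<omega> * of_real t)) - 2 * (\<Sum>n\<le>N. nsbf_term K \<omega> x n)
      = integral {-x..x} (\<lambda>t. (K22 K x t - K22_partial K N x t) * exp (\<i> * \<omega> * of_real t))"
    unfolding nsbf_partial_sum_eq_integral[OF \<open>0 < x\<close>] left_diff_distrib
    by (intro integral_diff[symmetric] integrable_continuous_real continuous_intros cont contN)
  also have "cmod \<dots> \<le> sqrt (integral {-x..x} (\<lambda>t. (cmod (K22 K x t - K22_partial K N x t))\<^sup>2))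
      * sqrt (integral {-x..x} (\<lambda>t. (cmod (exp (\<i> * \<omega> * of_real t)))\<^sup>2))"
    by (intro Cauchy_Schwarz_integral continuous_on_diff cont contN contE)
  also have "\<dots> = eps K N x * sqrt (sinh_quotient (Im \<omega>) x)"
    unfolding eps_def using has_integral_norm_exp_square[OF \<open>0 < x\<close>] by (simp add: integral_unique)
  finally show ?thesis .
qed

lemma eps_nonneg: "0 \<le> eps K N x"
proof -
  have "0 \<le> integral {-x..x} (\<lambda>t. (cmod (K22 K x t - K22_partial K N x t))\<^sup>2)"
    \<comment> \<open>A non-integrable function has integral 0 by convention, so the value is
      nonnegative in either case.\<close>
    by (cases "(\<lambda>t. (cmod (K22 K x t - K22_partial K N x t))\<^sup>2) integrable_on {-x..x}")
       (auto intro!: integral_nonneg simp: not_integrable_integral)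
  then show ?thesis by (simp add: eps_def)
qed

text \<open>On a bounded set the exponentials have a common mean-square bound \<open>M\<close>, so
  the error is at most \<open>eps K N x * M\<close> simultaneously for all \<omega> in
  \<open>S\<close>.\<close>

lemma nsbf_uniform_limit:
  assumes "0 < x" and cont: "continuous_on {-x..x} (K22 K x)" and S: "bounded S"
  shows "uniform_limit S (\<lambda>N \<omega>. \<Sum>n\<le>N. nsbf_term K \<omega> x n)
    (\<lambda>\<omega>. integral {-x..x} (\<lambda>t. K22 K x t * exp (\<i> * \<omega> * of_real t)) / 2) sequentially"
proof (rule uniform_limitI)
  fix e :: real assume "e > 0"
  obtain r where r: "\<And>\<omega>. \<omega> \<in> S \<Longrightarrow> cmod \<omega> \<le> r" using S unfolding bounded_iff by blast
  define M where "M = sqrt (2 * x * exp (2 * r * x))"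
  have "(\<lambda>N. eps K N x * M) \<longlonglongrightarrow> 0 * M"
    by (intro tendsto_intros eps_tendsto_0 assms)
  then have "eventually (\<lambda>N. eps K N x * M < e) sequentially"
    using \<open>e > 0\<close> by (auto dest: order_tendstoD)
  then show "\<forall>\<^sub>F N in sequentially. \<forall>\<omega>\<in>S. dist (\<Sum>n\<le>N. nsbf_term K \<omega> x n)
      (integral {-x..x} (\<lambda>t. K22 K x t * exp (\<i> * \<omega> * of_real t)) / 2) < e"
  proof eventually_elim
    case (elim N)
    show ?case
    proof
      fix \<omega> assume "\<omega> \<in> S"
      define F where "F = integral {-x..x} (\<lambda>t. K22 K x t * exp (\<i> * \<omega> * of_real t))"
      have "cmod (F - 2 * (\<Sum>n\<le>N. nsbf_term K \<omega> x n)) \<le> eps K N x * sqrt (sinh_quotient (Im \<omega>) x)"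
        unfolding F_def by (rule nsbf_partial_sum_error[OF assms(1,2)])
      also have "\<dots> \<le> eps K N x * M"
        unfolding M_def using r[OF \<open>\<omega> \<in> S\<close>] \<open>0 < x\<close>
        by (intro mult_left_mono real_sqrt_le_mono sinh_quotient_le eps_nonneg)
      finally have "cmod (F - 2 * (\<Sum>n\<le>N. nsbf_term K \<omega> x n)) < e" using elim by simp
      moreover have "F - 2 * (\<Sum>n\<le>N. nsbf_term K \<omega> x n) = 2 * (F / 2 - (\<Sum>n\<le>N. nsbf_term K \<omega> x n))"
        by simp
      ultimately have "2 * cmod (F / 2 - (\<Sum>n\<le>N. nsbf_term K \<omega> x n)) < e"
        by (metis norm_mult norm_numeral)
      then have "cmod (F / 2 - (\<Sum>n\<le>N. nsbf_term K \<omega> x n)) < e"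
        using norm_ge_zero[of "F / 2 - (\<Sum>n\<le>N. nsbf_term K \<omega> x n)"] by linarith
      then show "dist (\<Sum>n\<le>N. nsbf_term K \<omega> x n) (F / 2) < e"
        by (simp add: dist_norm norm_minus_commute)
    qed
  qed
qed

section \<open>Representation, convergence and error estimates\<close>

theorem theorem10:
  fixes b :: real
    and q :: "real \<Rightarrow> complex"
    and u :: "complex \<Rightarrow> real \<Rightarrow> complex"
    and K :: "real \<Rightarrow> real \<Rightarrow> complex"
  assumes "0 < b"
    and "C1_interval b q"
    and "\<And>\<omega>. sl_solution b q \<omega> (u \<omega>)"
    and "transmutation_kernel b q u K"
  shows "\<forall>x\<in>{0..b}.
      (\<forall>\<omega>. summable (nsbf_term K \<omega> x)) \<and>
      (\<forall>S. compact S \<longrightarrow>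
         uniform_limit S (\<lambda>N \<omega>. \<Sum>n\<le>N. nsbf_term K \<omega> x n) (\<lambda>\<omega>. \<Sum>n. nsbf_term K \<omega> x n) sequentially) \<and>
      (\<forall>\<omega>. \<omega> \<noteq> 0 \<longrightarrow>
         u \<omega> x =
           exp (\<i> * \<omega> * of_real x)
             * (1 + Qint q x / (2 * \<i> * \<omega>) + 1 / \<omega>\<^sup>2 * (q x / 4 - (Qint q x)\<^sup>2 / 8))
           - q 0 / 4 * (exp (- \<i> * \<omega> * of_real x) / \<omega>\<^sup>2)
           - 2 / \<omega>\<^sup>2 * (\<Sum>n. nsbf_term K \<omega> x n)) \<and>
      (\<forall>N. \<forall>\<omega>. \<omega> \<noteq> 0 \<longrightarrow>
         cmod (u \<omega> x - u_approx q K N \<omega> x)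
           \<le> 1 / (cmod \<omega>)\<^sup>2 * eps K N x * sqrt (sinh_quotient (Im \<omega>) x)) \<and>
      (\<forall>N. \<forall>\<omega>::real. \<omega> \<noteq> 0 \<longrightarrow>
         cmod (u (of_real \<omega>) x - u_approx q K N (of_real \<omega>) x)
           \<le> 1 / \<bar>\<omega>\<bar>\<^sup>2 * eps K N x * sqrt (2 * x))"
proof
  fix x assume "x \<in> {0..b}"
  have q: "continuous_on {0..b} q"
    using assms(2) has_vector_derivative_continuous continuous_on_eq_continuous_within
    unfolding C1_interval_def by blast
  define F where "F = (\<lambda>\<omega>. integral {-x..x} (\<lambda>t. K22 K x t * exp (\<i> * \<omega> * of_real t)))"
  \<comment> \<open>Everything is first stated with the Fourier transform \<open>F\<close> of
    \<open>K22\<close> in place of the infinite sum; \<open>F \<omega> / 2\<close> is identified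
    with that sum afterwards.\<close>
  have main: "(\<forall>S. compact S \<longrightarrow>
         uniform_limit S (\<lambda>N \<omega>. \<Sum>n\<le>N. nsbf_term K \<omega> x n) (\<lambda>\<omega>. F \<omega> / 2) sequentially) \<and>
      (\<forall>\<omega>. \<omega> \<noteq> 0 \<longrightarrow>
         u \<omega> x =
           exp (\<i> * \<omega> * of_real x)
             * (1 + Qint q x / (2 * \<i> * \<omega>) + 1 / \<omega>\<^sup>2 * (q x / 4 - (Qint q x)\<^sup>2 / 8))
           - q 0 / 4 * (exp (- \<i> * \<omega> * of_real x) / \<omega>\<^sup>2)
           - 1 / \<omega>\<^sup>2 * F \<omega>) \<and>
      (\<forall>N \<omega>. cmod (F \<omega> - 2 * (\<Sum>n\<le>N. nsbf_term K \<omega> x n)) \<le> eps K N x * sqrt (sinh_quotient (Im \<omega>) x))"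
  proof (cases "x = 0")
    case True
    \<comment> \<open>At \<open>x = 0\<close> the integrals run over a single point, so
      \<open>F\<close> and all terms vanish. The two q(0)/4 contributions cancel, leaving the
      initial value u = 1.\<close>
    have "nsbf_term K \<omega> 0 n = 0" for \<omega> n
      by (simp add: nsbf_term_def legendre_coeff_def)
    moreover have "u \<omega> 0 = 1" for \<omega> using assms(3) by (auto simp: sl_solution_def)
    ultimately show ?thesis
      using True by (auto simp: F_def Qint_def sinh_quotient_def uniform_limit_const field_simps)
  next
    case False
    then have x: "0 < x" "x \<le> b" using \<open>x \<in> {0..b}\<close> by auto
    from assms(4) have "C2_each_argument b K"
      and u: "u \<omega> x = exp (\<i> * \<omega> * of_real x) + integral {-x..x} (\<lambda>t. K x t * exp (\<i> * \<omega> * of_real t))"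
      and diag: "y \<in> {0..b} \<Longrightarrow> K y y = Qint q y / 2" and antidiag: "y \<in> {0..b} \<Longrightarrow> K y (-y) = 0"
      and eq: "(y, t) \<in> kernel_domain b \<Longrightarrow> K y t = Qint q ((y + t) / 2) / 2
          + integral {0..(y + t) / 2} (\<lambda>\<alpha>. integral {0..(y - t) / 2}
              (\<lambda>\<beta>. q (\<alpha> + \<beta>) * K (\<alpha> + \<beta>) (\<alpha> - \<beta>)))" for \<omega> y t
      using x unfolding transmutation_kernel_def by auto
    then obtain K\<^sub>2 K\<^sub>2\<^sub>2 where
        deriv: "\<And>x t. (x, t) \<in> kernel_domain b \<Longrightarrow> (K x has_vector_derivative K\<^sub>2 x t) (at t within {-x..x})"
          "\<And>x t. (x, t) \<in> kernel_domain b \<Longrightarrow> (K\<^sub>2 x has_vector_derivative K\<^sub>2\<^sub>2 x t) (at t within {-x..x})"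
        and cont: "continuous_on (kernel_domain b) (\<lambda>(x, t). K x t)"
          "continuous_on (kernel_domain b) (\<lambda>(x, t). K\<^sub>2\<^sub>2 x t)"
      unfolding C2_each_argument_def by fast
    have dom: "(x, t) \<in> kernel_domain b" if "t \<in> {-x..x}" for t
      using that x by (auto simp: kernel_domain_def)
    note ends = kernel_derivative_diagonal[OF q cont(1) diag antidiag eq x]
      kernel_derivative_antidiagonal[OF q cont(1) diag antidiag eq x]
    \<comment> \<open>The witness \<open>K\<^sub>2\<close> and the value read off from the integral
      equation are both derivatives of \<open>K x\<close> at the same point of a proper interval,
      hence equal; likewise at the left end.\<close>
    have K2_right: "K\<^sub>2 x x = q x / 4 - (Qint q x)\<^sup>2 / 8"
      by (rule vector_derivative_unique_within_closed_interval[of "-x" x x "K x"])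
         (use x ends(1) deriv(1)[OF dom] in auto)
    have K2_left: "K\<^sub>2 x (-x) = q 0 / 4"
      by (rule vector_derivative_unique_within_closed_interval[of "-x" x "-x" "K x"])
         (use x ends(2) deriv(1)[OF dom] in auto)
    have K22: "K22 K x t = K\<^sub>2\<^sub>2 x t" if "t \<in> {-x..x}" for t
      using K22_eqI[of x t K "K\<^sub>2 x"] x(1) that deriv dom by blast
    have contK22': "continuous_on {-x..x} (K\<^sub>2\<^sub>2 x)"
    proof -
      have "continuous_on {-x..x} (\<lambda>t. (\<lambda>(x, t). K\<^sub>2\<^sub>2 x t) (x, t))"
        by (intro continuous_on_compose2[OF cont(2)] continuous_intros) (auto intro: dom)
      then show ?thesis by simp
    qed
    then have contK22: "continuous_on {-x..x} (K22 K x)"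
      by (rule continuous_on_eq) (simp add: K22)
    have F: "F \<omega> = integral {-x..x} (\<lambda>t. K\<^sub>2\<^sub>2 x t * exp (\<i> * \<omega> * of_real t))" for \<omega>
      unfolding F_def by (intro integral_cong) (simp add: K22)
    have "u \<omega> x = exp (\<i> * \<omega> * of_real x)
             * (1 + Qint q x / (2 * \<i> * \<omega>) + 1 / \<omega>\<^sup>2 * (q x / 4 - (Qint q x)\<^sup>2 / 8))
           - q 0 / 4 * (exp (- \<i> * \<omega> * of_real x) / \<omega>\<^sup>2) - 1 / \<omega>\<^sup>2 * F \<omega>" if "\<omega> \<noteq> 0" for \<omega>
    proof -
      have "integral {-x..x} (\<lambda>t. K x t * exp (\<i> * \<omega> * of_real t))
          = (K x x / (\<i> * \<omega>) + K\<^sub>2 x x / \<omega>\<^sup>2) * exp (\<i> * \<omega> * of_real x)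
            - (K x (-x) / (\<i> * \<omega>) + K\<^sub>2 x (-x) / \<omega>\<^sup>2) * exp (\<i> * \<omega> * of_real (-x)) - 1 / \<omega>\<^sup>2 * F \<omega>"
        unfolding F using x that by (intro integral_exp_by_parts_twice deriv dom contK22') auto
      moreover have "K x x = Qint q x / 2" "K x (-x) = 0" using x diag antidiag by auto
      ultimately show ?thesis
        unfolding u K2_right K2_left by (simp add: algebra_simps diff_divide_distrib)
    qed
    then show ?thesis
      using nsbf_uniform_limit[OF x(1) contK22 compact_imp_bounded] nsbf_partial_sum_error[OF x(1) contK22]
      unfolding F_def by blast
  qed
  have sums: "nsbf_term K \<omega> x sums (F \<omega> / 2)" for \<omega>
  proof -
    \<comment> \<open>Pointwise convergence is uniform convergence on the compact singleton.\<close>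
    have "uniform_limit {\<omega>} (\<lambda>N \<omega>. \<Sum>n\<le>N. nsbf_term K \<omega> x n) (\<lambda>\<omega>. F \<omega> / 2) sequentially"
      using main compact_sing by blast
    then show ?thesis
      unfolding sums_def_le using tendsto_uniform_limitI by fastforce
  qed
  then have suminf: "(\<lambda>\<omega>. \<Sum>n. nsbf_term K \<omega> x n) = (\<lambda>\<omega>. F \<omega> / 2)"
    by (intro ext sums_unique[symmetric] sums)
  have error: "cmod (u \<omega> x - u_approx q K N \<omega> x)
      \<le> 1 / (cmod \<omega>)\<^sup>2 * eps K N x * sqrt (sinh_quotient (Im \<omega>) x)" if "\<omega> \<noteq> 0" for N \<omega>
  proof -
    have "u \<omega> x - u_approx q K N \<omega> x = - (1 / \<omega>\<^sup>2) * (F \<omega> - 2 * (\<Sum>n\<le>N. nsbf_term K \<omega> x n))"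
      unfolding u_approx_def main[THEN conjunct2, THEN conjunct1, rule_format, OF that]
      by (simp add: algebra_simps)
    then have "cmod (u \<omega> x - u_approx q K N \<omega> x)
        = 1 / (cmod \<omega>)\<^sup>2 * cmod (F \<omega> - 2 * (\<Sum>n\<le>N. nsbf_term K \<omega> x n))"
      by (simp add: norm_mult norm_divide norm_power)
    also have "\<dots> \<le> 1 / (cmod \<omega>)\<^sup>2 * (eps K N x * sqrt (sinh_quotient (Im \<omega>) x))"
      using main by (intro mult_left_mono) auto
    finally show ?thesis by (simp add: mult.assoc)
  qed
  have error_real: "cmod (u (of_real \<omega>) x - u_approx q K N (of_real \<omega>) x)
      \<le> 1 / \<bar>\<omega>\<bar>\<^sup>2 * eps K N x * sqrt (2 * x)" if "\<omega> \<noteq> 0" for N and \<omega> :: real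
    \<comment> \<open>The imaginary part is 0, so \<open>sinh_quotient\<close> takes its limiting
      value 2 x.\<close>
    using error[of "of_real \<omega>" N] that by (simp add: sinh_quotient_def)
  show "(\<forall>\<omega>. summable (nsbf_term K \<omega> x)) \<and>
      (\<forall>S. compact S \<longrightarrow>
         uniform_limit S (\<lambda>N \<omega>. \<Sum>n\<le>N. nsbf_term K \<omega> x n) (\<lambda>\<omega>. \<Sum>n. nsbf_term K \<omega> x n) sequentially) \<and>
      (\<forall>\<omega>. \<omega> \<noteq> 0 \<longrightarrow>
         u \<omega> x =
           exp (\<i> * \<omega> * of_real x)
             * (1 + Qint q x / (2 * \<i> * \<omega>) + 1 / \<omega>\<^sup>2 * (q x / 4 - (Qint q x)\<^sup>2 / 8))
           - q 0 / 4 * (exp (- \<i> * \<omega> * of_real x) / \<omega>\<^sup>2)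
           - 2 / \<omega>\<^sup>2 * (\<Sum>n. nsbf_term K \<omega> x n)) \<and>
      (\<forall>N. \<forall>\<omega>. \<omega> \<noteq> 0 \<longrightarrow>
         cmod (u \<omega> x - u_approx q K N \<omega> x)
           \<le> 1 / (cmod \<omega>)\<^sup>2 * eps K N x * sqrt (sinh_quotient (Im \<omega>) x)) \<and>
      (\<forall>N. \<forall>\<omega>::real. \<omega> \<noteq> 0 \<longrightarrow>
         cmod (u (of_real \<omega>) x - u_approx q K N (of_real \<omega>) x)
           \<le> 1 / \<bar>\<omega>\<bar>\<^sup>2 * eps K N x * sqrt (2 * x))"
    unfolding suminf
  proof (intro conjI allI impI)
    show "summable (nsbf_term K \<omega> x)" for \<omega> using sums by (rule sums_summable)
  next
    fix \<omega> :: complex assume "\<omega> \<noteq> 0"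
    \<comment> \<open>\<open>suminf\<close> equates functions of \<omega>; here its value at one
      point is needed.\<close>
    have "(\<Sum>n. nsbf_term K \<omega> x n) = F \<omega> / 2"
      using fun_cong[OF suminf] .
    then show "u \<omega> x =
           exp (\<i> * \<omega> * of_real x)
             * (1 + Qint q x / (2 * \<i> * \<omega>) + 1 / \<omega>\<^sup>2 * (q x / 4 - (Qint q x)\<^sup>2 / 8))
           - q 0 / 4 * (exp (- \<i> * \<omega> * of_real x) / \<omega>\<^sup>2)
           - 2 / \<omega>\<^sup>2 * (\<Sum>n. nsbf_term K \<omega> x n)"
      unfolding main[THEN conjunct2, THEN conjunct1, rule_format, OF \<open>\<omega> \<noteq> 0\<close>] by (simp only:) simp
  qed (use main error error_real in blast)+
qed

end
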